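(* Let $K$ be a field of characteristic $0$ and let $A_0=\{f\in K\{x\}: \frac{d}{dx}f=0\}$ be the algebra of constants. The algebra $A_0$ is a free (unital, non-associative) algebra generated by a set of variables $Y=\{y_1,y_2,\dots\}$, where $y_i$ is homogeneous of degree $d_i$, with $d_{i+1}\geq d_i$ for all $i$ and $d_1=3$. Identify $A_0$ with $K\{Y\}$, and let $\Delta':K\{Y\}\to K\{Y\}\otimes K\{Y\}$ be the restriction to $A_0$ of the co-addition of $K\{x\}$. Let $\Delta: K\{Y\}\to K\{Y\}\otimes K\{Y\}$ be the co-addition of the free algebra $K\{Y\}$, i.e. the algebra homomorphism with $\Delta(y_i)=y_i\otimes 1+1\otimes y_i$ for all $i$. Then $(K\{Y\},\Delta')$ is isomorphic to $(K\{Y\},\Delta)$: there is an algebra isomorphism $\varphi:K\{Y\}\to K\{Y\}$ with $$\Delta=(\varphi\otimes\varphi)\circ\Delta'\circ\varphi^{-1}.$$ Moreover $\varphi$ is strict in the sense that its linear part is the identity on the vector space generated by all $y_i$.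
   Context: For a set $X$, $M(X)$ is the free magma (without unit) on $X$ (parenthesized words, i.e. planar binary rooted trees with leaves labeled by $X$). $K\{X\}$ is the free unital, not necessarily associative or commutative, $K$-algebra on $X$, with $K$-basis $M(X)\cup\{1\}$. $K\{x\}$ is graded by the number of leaves. The co-addition on $K\{x\}$ is the unital algebra homomorphism $K\{x\}\to K\{x\}\otimes K\{x\}$ (component-wise multiplication on the tensor product) with $x\mapsto x\otimes 1+1\otimes x$; it maps $A_0$ into $A_0\otimes A_0$. $\frac{d}{dx}$ is the $K$-linear derivation of $K\{x\}$ with $\frac{d}{dx}x=1$. The linear part of $\varphi$ is the degree-one part of the images $\varphi(y_i)$ with respect to the grading of $K\{Y\}$ in which every $y_j$ has degree $1$; so strictness means that $\varphi(y_i)$ equals $y_i$ plus a linear combination of monomials in $Y$ with at least two factors. *)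

theory Defs
  imports Complex_Main "HOL-Library.Poly_Mapping"
begin

section \<open>Vector spaces with a given basis\<close>

text \<open>The vector space with basis \<open>'b\<close> is the type of finitely supported functions
  \<open>'b \<Rightarrow>\<^sub>0 'k\<close>. The library product on this type needs a monoid of basis
  elements and is not used; all products below are bilinear extensions of binary operations.\<close>

definition scale :: "'k::field \<Rightarrow> ('b \<Rightarrow>\<^sub>0 'k) \<Rightarrow> 'b \<Rightarrow>\<^sub>0 'k"
  where "scale c p = Poly_Mapping.map (\<lambda>a. c * a) p"

definition basis :: "'b \<Rightarrow> 'b \<Rightarrow>\<^sub>0 'k::field"
  where "basis b = Poly_Mapping.single b 1"

definition lin_ext :: "('b \<Rightarrow> 'c \<Rightarrow>\<^sub>0 'k) \<Rightarrow> ('b \<Rightarrow>\<^sub>0 'k::field) \<Rightarrow> 'c \<Rightarrow>\<^sub>0 'k"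
  where "lin_ext g p = (\<Sum>b\<in>Poly_Mapping.keys p. scale (Poly_Mapping.lookup p b) (g b))"

definition bilin_ext ::
    "('a \<Rightarrow> 'b \<Rightarrow> 'c) \<Rightarrow> ('a \<Rightarrow>\<^sub>0 'k::field) \<Rightarrow> ('b \<Rightarrow>\<^sub>0 'k) \<Rightarrow> 'c \<Rightarrow>\<^sub>0 'k"
  where "bilin_ext m p q = lin_ext (\<lambda>a. lin_ext (\<lambda>b. basis (m a b)) q) p"

lemma lookup_scale [simp]: "Poly_Mapping.lookup (scale c p) b = c * Poly_Mapping.lookup p b"
  by (simp add: scale_def Poly_Mapping.map.rep_eq when_def)

lemma vector_space_scale: "vector_space (scale :: 'k::field \<Rightarrow> ('b \<Rightarrow>\<^sub>0 'k) \<Rightarrow> _)"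
  by unfold_locales (auto intro!: poly_mapping_eqI simp: lookup_add algebra_simps)

lemma linear_scaleI:
  fixes f :: "('b \<Rightarrow>\<^sub>0 'k::field) \<Rightarrow> 'c \<Rightarrow>\<^sub>0 'k"
  assumes "\<And>p q. f (p + q) = f p + f q" "\<And>c p. f (scale c p) = scale c (f p)"
  shows "Vector_Spaces.linear scale scale f"
  unfolding Vector_Spaces.linear_def module_hom_def module_iff_vector_space module_hom_axioms_def
  by (intro conjI allI vector_space_scale assms)

lemma linear_id_scale: "Vector_Spaces.linear scale scale (\<lambda>p :: 'b \<Rightarrow>\<^sub>0 'k::field. p)"
  by (intro linear_scaleI refl)

lemma linear_comp:
  fixes f :: "('c \<Rightarrow>\<^sub>0 'k::field) \<Rightarrow> 'd \<Rightarrow>\<^sub>0 'k" and g :: "('b \<Rightarrow>\<^sub>0 'k) \<Rightarrow> 'c \<Rightarrow>\<^sub>0 'k"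
  assumes f: "Vector_Spaces.linear scale scale f" and g: "Vector_Spaces.linear scale scale g"
  shows "Vector_Spaces.linear scale scale (\<lambda>p. f (g p))"
  using Vector_Spaces.linear_compose[OF g f] by (simp add: o_def)

lemma linear_plus:
  fixes f g :: "('b \<Rightarrow>\<^sub>0 'k::field) \<Rightarrow> 'c \<Rightarrow>\<^sub>0 'k"
  assumes f: "Vector_Spaces.linear scale scale f" and g: "Vector_Spaces.linear scale scale g"
  shows "Vector_Spaces.linear scale scale (\<lambda>p. f p + g p)"
proof -
  interpret vector_space "scale :: 'k \<Rightarrow> ('c \<Rightarrow>\<^sub>0 'k) \<Rightarrow> _" by (rule vector_space_scale)
  interpret f: Vector_Spaces.linear scale scale f by (rule f)
  interpret g: Vector_Spaces.linear scale scale g by (rule g)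
  show ?thesis
    by (rule linear_scaleI) (simp_all add: f.add g.add f.scale g.scale scale_right_distrib)
qed

lemma lin_ext_superset:
  fixes g :: "'b \<Rightarrow> 'c \<Rightarrow>\<^sub>0 'k::field"
  assumes "finite A" "Poly_Mapping.keys p \<subseteq> A"
  shows "lin_ext g p = (\<Sum>b\<in>A. scale (Poly_Mapping.lookup p b) (g b))"
proof -
  interpret vector_space "scale :: 'k \<Rightarrow> ('c \<Rightarrow>\<^sub>0 'k) \<Rightarrow> _" by (rule vector_space_scale)
  show ?thesis unfolding lin_ext_def
    by (rule sum.mono_neutral_left) (use assms in \<open>auto simp: in_keys_iff\<close>)
qed

lemma linear_lin_ext:
  fixes g :: "'b \<Rightarrow> 'c \<Rightarrow>\<^sub>0 'k::field"
  shows "Vector_Spaces.linear scale scale (lin_ext g)"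
proof -
  interpret vector_space "scale :: 'k \<Rightarrow> ('c \<Rightarrow>\<^sub>0 'k) \<Rightarrow> _" by (rule vector_space_scale)
  have add: "lin_ext g (p + q) = lin_ext g p + lin_ext g q" for p q
  proof -
    let ?A = "Poly_Mapping.keys p \<union> Poly_Mapping.keys q"
    have "finite ?A" "Poly_Mapping.keys (p + q) \<subseteq> ?A"
      using Poly_Mapping.keys_add[of p q] by auto
    then show ?thesis
      by (simp add: lin_ext_superset[of ?A] lookup_add scale_left_distrib sum.distrib)
  qed
  have scl: "lin_ext g (scale c p) = scale c (lin_ext g p)" for c p
  proof -
    have "Poly_Mapping.keys (scale c p) \<subseteq> Poly_Mapping.keys p"
      by (auto simp: in_keys_iff)
    then show ?thesis
      by (simp add: lin_ext_superset[of "Poly_Mapping.keys p"] scale_sum_right)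
  qed
  show ?thesis
    by (rule linear_scaleI[OF add scl])
qed

lemma lin_ext_basis [simp]: "lin_ext g (basis b) = g b"
  by (auto simp: lin_ext_def basis_def intro!: poly_mapping_eqI)

lemma bilin_ext_basis [simp]: "bilin_ext m (basis a) (basis b) = basis (m a b)"
  by (simp add: bilin_ext_def)

lemma linear_bilin_ext_left: "Vector_Spaces.linear scale scale (\<lambda>p. bilin_ext m p q)"
  unfolding bilin_ext_def by (rule linear_lin_ext)

lemma linear_bilin_ext_right:
  fixes p :: "'a \<Rightarrow>\<^sub>0 'k::field" and m :: "'a \<Rightarrow> 'b \<Rightarrow> 'c"
  shows "Vector_Spaces.linear scale scale (bilin_ext m p)"
proof -
  interpret vector_space "scale :: 'k \<Rightarrow> ('c \<Rightarrow>\<^sub>0 'k) \<Rightarrow> _" by (rule vector_space_scale)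
  interpret l: Vector_Spaces.linear scale scale "lin_ext g" for g :: "'b \<Rightarrow> 'c \<Rightarrow>\<^sub>0 'k"
    by (rule linear_lin_ext)
  have "bilin_ext m p (q + r) = bilin_ext m p q + bilin_ext m p r" for q r
    unfolding bilin_ext_def lin_ext_def[of _ p]
    by (simp add: l.add scale_right_distrib sum.distrib)
  moreover have "bilin_ext m p (scale c q) = scale c (bilin_ext m p q)" for c q
    unfolding bilin_ext_def lin_ext_def[of _ p]
    by (simp add: l.scale scale_sum_right mult.commute)
  ultimately show ?thesis
    by (rule linear_scaleI)
qed

lemma linear_eq_on_basis:
  fixes f g :: "('b \<Rightarrow>\<^sub>0 'k::field) \<Rightarrow> 'c \<Rightarrow>\<^sub>0 'k"
  assumes f: "Vector_Spaces.linear scale scale f" and g: "Vector_Spaces.linear scale scale g"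
    and eq: "\<And>b. f (basis b) = g (basis b)"
  shows "f p = g p"
proof -
  interpret f: Vector_Spaces.linear scale scale f by (rule f)
  interpret g: Vector_Spaces.linear scale scale g by (rule g)
  have "p = (\<Sum>b\<in>Poly_Mapping.keys p. scale (Poly_Mapping.lookup p b) (basis b))"
  proof (rule poly_mapping_eqI)
    fix a
    have "(\<Sum>b\<in>Poly_Mapping.keys p. Poly_Mapping.lookup p b * (1 when b = a)) =
        (\<Sum>b\<in>Poly_Mapping.keys p. if b = a then Poly_Mapping.lookup p b else 0)"
      by (intro sum.cong) (auto simp: when_def)
    also have "\<dots> = Poly_Mapping.lookup p a"
      by (simp add: in_keys_iff)
    finally show "Poly_Mapping.lookup p a = Poly_Mapping.lookup
        (\<Sum>b\<in>Poly_Mapping.keys p. scale (Poly_Mapping.lookup p b) (basis b)) a"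
      by (simp only: lookup_sum lookup_scale basis_def lookup_single)
  qed
  then have "h p = h (\<Sum>b\<in>Poly_Mapping.keys p. scale (Poly_Mapping.lookup p b) (basis b))"
    for h :: "('b \<Rightarrow>\<^sub>0 'k) \<Rightarrow> 'c \<Rightarrow>\<^sub>0 'k"
    by (rule arg_cong)
  from this[of f] this[of g] show ?thesis
    by (simp only: f.sum g.sum f.scale g.scale eq)
qed

section \<open>The free unital non-associative algebra\<close>

datatype 'x magma = Leaf 'x | Node "'x magma" "'x magma"

primrec leaves :: "'x magma \<Rightarrow> nat"
  where
    "leaves (Leaf x) = 1"
  | "leaves (Node s t) = leaves s + leaves t"

text \<open>\<open>'x magma option\<close> is the free magma with a unit adjoined; \<open>None\<close> is the unit.\<close>

fun umul :: "'x magma option \<Rightarrow> 'x magma option \<Rightarrow> 'x magma option"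
  where
    "umul None v = v"
  | "umul u None = u"
  | "umul (Some s) (Some t) = Some (Node s t)"

primrec deg :: "'x magma option \<Rightarrow> nat"
  where
    "deg None = 0"
  | "deg (Some t) = leaves t"

type_synonym ('x, 'k) free_alg = "'x magma option \<Rightarrow>\<^sub>0 'k"

definition fmul :: "('x, 'k::field) free_alg \<Rightarrow> ('x, 'k) free_alg \<Rightarrow> ('x, 'k) free_alg"
  where "fmul = bilin_ext umul"

definition fone :: "('x, 'k::field) free_alg"
  where "fone = basis None"

definition gen :: "'x \<Rightarrow> ('x, 'k::field) free_alg"
  where "gen x = basis (Some (Leaf x))"

definition homogeneous :: "('x, 'k::field) free_alg \<Rightarrow> nat \<Rightarrow> bool"
  where "homogeneous f n \<longleftrightarrow> (\<forall>u\<in>Poly_Mapping.keys f. deg u = n)"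

text \<open>\<open>V \<otimes> W\<close> is the vector space on pairs of basis elements.\<close>

type_synonym ('x, 'k) free_alg2 = "('x magma option \<times> 'x magma option) \<Rightarrow>\<^sub>0 'k"

definition tensor :: "('a \<Rightarrow>\<^sub>0 'k::field) \<Rightarrow> ('b \<Rightarrow>\<^sub>0 'k) \<Rightarrow> ('a \<times> 'b) \<Rightarrow>\<^sub>0 'k"
  where "tensor = bilin_ext Pair"

definition tensor_map ::
    "(('a \<Rightarrow>\<^sub>0 'k::field) \<Rightarrow> ('c \<Rightarrow>\<^sub>0 'k)) \<Rightarrow> (('b \<Rightarrow>\<^sub>0 'k) \<Rightarrow> ('d \<Rightarrow>\<^sub>0 'k)) \<Rightarrow>
      (('a \<times> 'b) \<Rightarrow>\<^sub>0 'k) \<Rightarrow> (('c \<times> 'd) \<Rightarrow>\<^sub>0 'k)"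
  where "tensor_map f g = lin_ext (\<lambda>(a, b). tensor (f (basis a)) (g (basis b)))"

definition tmul :: "('x, 'k::field) free_alg2 \<Rightarrow> ('x, 'k) free_alg2 \<Rightarrow> ('x, 'k) free_alg2"
  where "tmul = bilin_ext (\<lambda>(a, b) (c, d). (umul a c, umul b d))"

definition tone :: "('x, 'k::field) free_alg2"
  where "tone = tensor fone fone"

definition alg_hom ::
    "(('a \<Rightarrow>\<^sub>0 'k::field) \<Rightarrow> ('a \<Rightarrow>\<^sub>0 'k) \<Rightarrow> ('a \<Rightarrow>\<^sub>0 'k)) \<Rightarrow> ('a \<Rightarrow>\<^sub>0 'k) \<Rightarrow>
     (('b \<Rightarrow>\<^sub>0 'k) \<Rightarrow> ('b \<Rightarrow>\<^sub>0 'k) \<Rightarrow> ('b \<Rightarrow>\<^sub>0 'k)) \<Rightarrow> ('b \<Rightarrow>\<^sub>0 'k) \<Rightarrow>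
     (('a \<Rightarrow>\<^sub>0 'k) \<Rightarrow> ('b \<Rightarrow>\<^sub>0 'k)) \<Rightarrow> bool"
  where "alg_hom mul1 one1 mul2 one2 f \<longleftrightarrow>
    Vector_Spaces.linear scale scale f \<and> f one1 = one2 \<and>
    (\<forall>p q. f (mul1 p q) = mul2 (f p) (f q))"

text \<open>The algebra homomorphism from \<open>K{X}\<close> that is given on the variables
  (see \<open>alg_hom_subst\<close> and \<open>alg_hom_unique\<close> below).\<close>

primrec magma_eval :: "('b \<Rightarrow> 'b \<Rightarrow> 'b) \<Rightarrow> ('x \<Rightarrow> 'b) \<Rightarrow> 'x magma \<Rightarrow> 'b"
  where
    "magma_eval mul h (Leaf x) = h x"
  | "magma_eval mul h (Node s t) = mul (magma_eval mul h s) (magma_eval mul h t)"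

definition subst ::
    "(('b \<Rightarrow>\<^sub>0 'k::field) \<Rightarrow> ('b \<Rightarrow>\<^sub>0 'k) \<Rightarrow> ('b \<Rightarrow>\<^sub>0 'k)) \<Rightarrow> ('b \<Rightarrow>\<^sub>0 'k) \<Rightarrow>
     ('x \<Rightarrow> ('b \<Rightarrow>\<^sub>0 'k)) \<Rightarrow> ('x, 'k) free_alg \<Rightarrow> ('b \<Rightarrow>\<^sub>0 'k)"
  where "subst mul one h = lin_ext (case_option one (magma_eval mul h))"

abbreviation fsubst ::
    "('y \<Rightarrow> ('x, 'k::field) free_alg) \<Rightarrow> ('y, 'k) free_alg \<Rightarrow> ('x, 'k) free_alg"
  where "fsubst \<equiv> subst fmul fone"

definition coadd :: "('x, 'k::field) free_alg \<Rightarrow> ('x, 'k) free_alg2"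
  where "coadd = subst tmul tone (\<lambda>x. tensor (gen x) fone + tensor fone (gen x))"

lemma alg_hom_unique:
  assumes f: "alg_hom fmul fone mul one f" and g: "alg_hom fmul fone mul one g"
    and eq: "\<And>x. f (gen x) = g (gen x)"
  shows "f = g"
proof
  fix p
  have node: "basis (Some (Node s t)) = fmul (basis (Some s)) (basis (Some t))"
    for s t :: "'a magma"
    by (simp add: fmul_def)
  have "f (basis (Some t)) = g (basis (Some t))" for t
    by (induction t) (use f g eq in \<open>auto simp: node alg_hom_def gen_def\<close>)
  moreover have "f (basis None) = g (basis None)"
    using f g by (simp add: alg_hom_def fone_def)
  ultimately have "f (basis u) = g (basis u)" for u
    by (cases u) auto
  then show "f p = g p"
    using f g unfolding alg_hom_def by (metis linear_eq_on_basis)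
qed

lemma alg_hom_subst:
  fixes one :: "'b \<Rightarrow>\<^sub>0 'k::field" and h :: "'x \<Rightarrow> 'b \<Rightarrow>\<^sub>0 'k"
  assumes left: "\<And>p. bilin_ext m one p = p" and right: "\<And>p. bilin_ext m p one = p"
  shows "alg_hom fmul fone (bilin_ext m) one (subst (bilin_ext m) one h)"
proof -
  let ?f = "subst (bilin_ext m) one h"
  have lin: "Vector_Spaces.linear scale scale ?f"
    unfolding subst_def by (rule linear_lin_ext)
  have unit: "?f fone = one"
    by (simp add: subst_def fone_def)
  have b: "?f (fmul (basis u) (basis v)) = bilin_ext m (?f (basis u)) (?f (basis v))" for u v
    using left right by (cases u; cases v) (simp_all add: subst_def fmul_def)
  have 1: "?f (fmul (basis u) q) = bilin_ext m (?f (basis u)) (?f q)" for u q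
    by (rule linear_eq_on_basis[where f = "\<lambda>q. ?f (fmul (basis u) q)"
          and g = "\<lambda>q. bilin_ext m (?f (basis u)) (?f q)"])
      (unfold fmul_def, rule linear_comp[OF lin linear_bilin_ext_right],
        rule linear_comp[OF linear_bilin_ext_right lin], rule b[unfolded fmul_def])
  have "?f (fmul p q) = bilin_ext m (?f p) (?f q)" for p q
    by (rule linear_eq_on_basis[where f = "\<lambda>p. ?f (fmul p q)"
          and g = "\<lambda>p. bilin_ext m (?f p) (?f q)"])
      (unfold fmul_def, rule linear_comp[OF lin linear_bilin_ext_left],
        rule linear_comp[OF linear_bilin_ext_left lin], rule 1[unfolded fmul_def])
  then show ?thesis
    using lin unit by (simp add: alg_hom_def)
qed

lemma umul_None_right [simp]: "umul u None = u"
  by (cases u) auto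

lemma fone_unit: "fmul fone p = p" "fmul p fone = p"
proof -
  show "fmul fone p = p"
    unfolding fmul_def fone_def
    by (rule linear_eq_on_basis[OF linear_bilin_ext_right linear_id_scale]) simp
  show "fmul p fone = p"
    unfolding fmul_def fone_def
    by (rule linear_eq_on_basis[OF linear_bilin_ext_left linear_id_scale]) simp
qed

lemma tone_unit: "tmul tone p = p" "tmul p tone = p"
proof -
  show "tmul tone p = p"
    unfolding tmul_def tone_def fone_def tensor_def bilin_ext_basis
    by (rule linear_eq_on_basis[OF linear_bilin_ext_right linear_id_scale])
      (simp split: prod.split)
  show "tmul p tone = p"
    unfolding tmul_def tone_def fone_def tensor_def bilin_ext_basis
    by (rule linear_eq_on_basis[OF linear_bilin_ext_left linear_id_scale])
      (simp split: prod.split)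
qed

lemma alg_hom_fsubst: "alg_hom fmul fone fmul fone (fsubst h)"
  using alg_hom_subst[OF fone_unit[unfolded fmul_def]] by (simp add: fmul_def)

lemma fsubst_gen: "fsubst h (gen x) = h x"
  by (simp add: subst_def gen_def)

lemma alg_hom_coadd: "alg_hom fmul fone tmul tone coadd"
  using alg_hom_subst[OF tone_unit[unfolded tmul_def]] by (simp add: tmul_def coadd_def)

lemma coadd_gen: "coadd (gen x) = tensor (gen x) fone + tensor fone (gen x)"
  by (simp add: coadd_def subst_def gen_def)

section \<open>Constants in one variable\<close>

text \<open>\<open>K{x}\<close> is the free algebra on the one-element type \<open>unit\<close>.\<close>

primrec ddx_magma :: "unit magma \<Rightarrow> (unit, 'k::field) free_alg"
  where
    "ddx_magma (Leaf x) = fone"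
  | "ddx_magma (Node s t) =
      fmul (ddx_magma s) (basis (Some t)) + fmul (basis (Some s)) (ddx_magma t)"

definition ddx :: "(unit, 'k::field) free_alg \<Rightarrow> (unit, 'k) free_alg"
  where "ddx = lin_ext (case_option 0 ddx_magma)"

definition constants :: "(unit, 'k::field) free_alg set"
  where "constants = {f. ddx f = 0}"

lemma linear_ddx: "Vector_Spaces.linear scale scale ddx"
  unfolding ddx_def by (rule linear_lin_ext)

lemma ddx_gen: "ddx (gen x) = fone"
  by (simp add: ddx_def gen_def)

lemma ddx_fmul:
  fixes p q :: "(unit, 'k::field) free_alg"
  shows "ddx (fmul p q) = fmul (ddx p) q + fmul p (ddx q)"
proof -
  have l: "Vector_Spaces.linear scale scale (\<lambda>p. fmul p r)"
    "Vector_Spaces.linear scale scale (fmul r)" for r :: "(unit, 'k) free_alg"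
    unfolding fmul_def by (rule linear_bilin_ext_left linear_bilin_ext_right)+
  have z: "fmul 0 r = 0" "fmul r 0 = 0" for r :: "(unit, 'k) free_alg"
    by (simp_all add: module_hom.zero[OF l(1)[unfolded module_hom_iff_linear[symmetric]]]
        module_hom.zero[OF l(2)[unfolded module_hom_iff_linear[symmetric]]])
  have unit: "fmul (basis None) r = r" "fmul r (basis None) = r" for r :: "(unit, 'k) free_alg"
    using fone_unit[of r] by (simp_all add: fone_def)
  have prod: "fmul (basis u) (basis v) = (basis (umul u v) :: (unit, 'k) free_alg)" for u v :: "unit magma option"
    by (simp add: fmul_def)
  have d: "ddx (basis None :: (unit, 'k) free_alg) = 0"
    "ddx (basis (Some t) :: (unit, 'k) free_alg) = ddx_magma t" for t
    by (simp_all add: ddx_def)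
  have b: "ddx (fmul (basis u) (basis v) :: (unit, 'k) free_alg) =
      fmul (ddx (basis u)) (basis v) + fmul (basis u) (ddx (basis v))" for u v
    by (cases u; cases v) (simp_all add: prod d z unit)
  have 1: "ddx (fmul (basis u) q) = fmul (ddx (basis u)) q + fmul (basis u) (ddx q)"
    for u and q :: "(unit, 'k) free_alg"
    by (rule linear_eq_on_basis[where f = "\<lambda>q. ddx (fmul (basis u) q)"
          and g = "\<lambda>q. fmul (ddx (basis u)) q + fmul (basis u) (ddx q)"])
      (rule linear_comp[OF linear_ddx l(2)],
        rule linear_plus[OF l(2) linear_comp[OF l(2) linear_ddx]], rule b)
  show ?thesis
    by (rule linear_eq_on_basis[where f = "\<lambda>p. ddx (fmul p q)"
          and g = "\<lambda>p. fmul (ddx p) q + fmul p (ddx q)"])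
      (rule linear_comp[OF linear_ddx l(1)],
        rule linear_plus[OF linear_comp[OF l(1) linear_ddx] l(1)], rule 1)
qed

text \<open>\<open>y 0, y 1, \<dots>\<close> stand for \<open>y\<^sub>1, y\<^sub>2, \<dots>\<close>. That the algebra of constants is free on
  them means that \<open>fsubst y\<close> identifies \<open>K{Y}\<close> with it.\<close>

definition free_generators ::
    "(nat \<Rightarrow> (unit, 'k::field) free_alg) \<Rightarrow> (nat \<Rightarrow> nat) \<Rightarrow> bool"
  where "free_generators y d \<longleftrightarrow>
    bij_betw (fsubst y) UNIV constants \<and>
    (\<forall>i. homogeneous (y i) (d i)) \<and> (\<forall>i. d i \<le> d (Suc i)) \<and> d 0 = 3"

text \<open>\<open>D\<close> is the restriction of the co-addition of \<open>K{x}\<close> to the constants, transported to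
  \<open>K{Y}\<close> along the identification \<open>fsubst y\<close>.\<close>

definition restricted_coadd ::
    "(nat \<Rightarrow> (unit, 'k::field) free_alg) \<Rightarrow> ((nat, 'k) free_alg \<Rightarrow> (nat, 'k) free_alg2) \<Rightarrow> bool"
  where "restricted_coadd y D \<longleftrightarrow>
    (\<forall>f. tensor_map (fsubst y) (fsubst y) (D f) = coadd (fsubst y f))"

definition alg_iso :: "(('x, 'k::field) free_alg \<Rightarrow> ('y, 'k) free_alg) \<Rightarrow> bool"
  where "alg_iso f \<longleftrightarrow> alg_hom fmul fone fmul fone f \<and> bij f"

definition strict :: "(('y, 'k::field) free_alg \<Rightarrow> ('y, 'k) free_alg) \<Rightarrow> bool"
  where "strict f \<longleftrightarrow> (\<forall>i. \<forall>u\<in>Poly_Mapping.keys (f (gen i) - gen i). deg u \<ge> 2)"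

end

theory Submission
  imports Defs "HOL-Library.Countable_Set" "HOL-Library.Infinite_Set"
begin

text \<open>Write \<open>R\<close> for right multiplication by \<open>x\<close> and \<open>A\<^sub>0\<close> for the algebra of constants.

  Existence of free generators. Since \<open>d/dx \<circ> R = R \<circ> d/dx + id\<close> and \<open>d/dx\<close> is locally
  nilpotent, \<open>d/dx \<circ> R\<close> is bijective in characteristic \<open>0\<close> (\<open>bij_ddx_times_x\<close>), so that
  \<open>K{x} = A\<^sub>0 \<oplus> R K{x}\<close>. Therefore \<open>A\<^sub>0\<close> has a basis indexed by \<open>1\<close> and the
  \<^emph>\<open>normal\<close> trees, those that do not end in \<open>x\<close>: the projection of a normal tree to
  \<open>A\<^sub>0\<close> differs from it only by trees ending in \<open>x\<close>. The normal trees are a free magma on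
  those that are not a product of two normal trees, and the projections of the latter generate
  \<open>A\<^sub>0\<close> freely, because monomials in them have unitriangular coefficients at the normal trees
  (\<open>bij_betw_fsubst_const_part\<close>).

  Restricting the co-addition. The derivative of either factor of \<open>\<Delta> c\<close> is
  \<open>\<Delta> (dc/dx)\<close> (\<open>ddx_left_coadd\<close>), so \<open>\<Delta>\<close> maps constants to
  \<open>A\<^sub>0 \<otimes> A\<^sub>0\<close>.

  The isomorphism. It suffices to find, for every free generator \<open>y\<^sub>i\<close>, a primitive constant
  that is congruent to \<open>y\<^sub>i\<close> modulo products of two elements of the augmentation ideal of
  \<open>A\<^sub>0\<close>: then \<open>y\<^sub>i \<mapsto> z\<^sub>i\<close> extends to a strict automorphism of \<open>K{Y}\<close>
  that carries \<open>\<Delta>\<close> to \<open>\<Delta>'\<close>. The Dynkin operator \<open>\<delta>\<close>, defined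
  recursively by \<open>deg h \<cdot> h = \<Sum> h\<^sub>1 \<cdot> \<delta> h\<^sub>2\<close>, provides it. Its values are
  primitive by cocommutativity and coassociativity alone, without associativity of the product
  (\<open>primitive_dynkin_monomial\<close>), and primitive elements without linear term are constants
  (\<open>primitive_imp_constant\<close>). As \<open>\<Delta> y\<^sub>i\<close> is in \<open>A\<^sub>0 \<otimes> A\<^sub>0\<close>, the
  recursion expresses \<open>\<delta> y\<^sub>i - d\<^sub>i y\<^sub>i\<close> by products of constants of smaller degree,
  so \<open>z\<^sub>i = \<delta> y\<^sub>i / d\<^sub>i\<close> is as desired.\<close>

section \<open>Linear algebra with a given basis\<close>

abbreviation lin :: "(('b \<Rightarrow>\<^sub>0 'k::field) \<Rightarrow> ('c \<Rightarrow>\<^sub>0 'k)) \<Rightarrow> bool"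
  where "lin \<equiv> Vector_Spaces.linear scale scale"

abbreviation coeff :: "('b \<Rightarrow>\<^sub>0 'k::field) \<Rightarrow> 'b \<Rightarrow> 'k"
  where "coeff \<equiv> Poly_Mapping.lookup"

abbreviation supp :: "('b \<Rightarrow>\<^sub>0 'k::field) \<Rightarrow> 'b set"
  where "supp \<equiv> Poly_Mapping.keys"

lemma coeff_basis: "coeff (basis b :: 'b \<Rightarrow>\<^sub>0 'k::field) c = (if b = c then 1 else 0)"
  by (simp add: basis_def lookup_single when_def)

lemma supp_basis [simp]: "supp (basis b :: 'b \<Rightarrow>\<^sub>0 'k::field) = {b}"
  by (simp add: basis_def)

lemma scale_simps [simp]:
  "scale c 0 = 0" "scale 0 p = 0" "scale 1 p = p" "scale a (scale b p) = scale (a * b) p"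
  by (auto intro!: poly_mapping_eqI)

lemma scale_distribs:
  "scale c (p + q) = scale c p + scale c q" "scale (a + b) p = scale a p + scale b p"
  "scale c (p - q) = scale c p - scale c q" "scale c (- p) = - scale c p"
  by (auto intro!: poly_mapping_eqI simp: lookup_add lookup_minus algebra_simps)

lemma lin_zero: "lin f \<Longrightarrow> f 0 = 0"
  by (metis Vector_Spaces.linear_iff scale_simps(2))

lemma lin_add: "lin f \<Longrightarrow> f (p + q) = f p + f q"
  by (simp add: Vector_Spaces.linear_iff)

lemma lin_scale: "lin f \<Longrightarrow> f (scale c p) = scale c (f p)"
  by (simp add: Vector_Spaces.linear_iff)

lemma lin_diff:
  assumes "lin f"
  shows "f (p - q) = f p - f q"
  using lin_add[OF assms, of "p - q" q] by (simp add: algebra_simps)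

lemma lin_scaled: "lin (\<lambda>p. scale c p)"
  by (rule linear_scaleI) (simp_all add: scale_distribs mult.commute)

lemma lin_minus:
  assumes "lin f" "lin g"
  shows "lin (\<lambda>p. f p - g p)"
  by (rule linear_scaleI) (simp_all add: lin_add lin_scale assms scale_distribs)

lemma lin_inv:
  assumes "lin f" "bij f"
  shows "lin (inv f)"
proof (rule linear_scaleI)
  have *: "f (inv f p) = p" for p
    using assms(2) by (simp add: bij_is_surj surj_f_inv_f)
  show "inv f (p + q) = inv f p + inv f q" for p q
    by (rule inv_f_eq) (simp_all add: assms bij_is_inj lin_add *)
  show "inv f (scale c p) = scale c (inv f p)" for c p
    by (rule inv_f_eq) (simp_all add: assms bij_is_inj lin_scale *)
qed

lemma coeff_lin_ext: "coeff (lin_ext g p) c = (\<Sum>b\<in>supp p. coeff p b * coeff (g b) c)"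
  by (simp add: lin_ext_def lookup_sum)

lemma lin_ext_basis_id: "lin_ext basis p = p"
  by (rule linear_eq_on_basis[OF linear_lin_ext linear_id_scale]) simp

lemma lin_as_lin_ext: "lin f \<Longrightarrow> f p = lin_ext (\<lambda>b. f (basis b)) p"
  using linear_eq_on_basis[OF _ linear_lin_ext, of f "\<lambda>b. f (basis b)" p] by simp

lemma lin_ext_cong: "(\<And>b. b \<in> supp p \<Longrightarrow> g b = h b) \<Longrightarrow> lin_ext g p = lin_ext h p"
  by (simp add: lin_ext_def)

lemma lin_lin_ext:
  assumes "lin f"
  shows "f (lin_ext g p) = lin_ext (\<lambda>b. f (g b)) p"
  by (rule linear_eq_on_basis[OF linear_comp[OF assms linear_lin_ext] linear_lin_ext]) simp

lemma supp_lin_ext: "supp (lin_ext g p) \<subseteq> (\<Union>b\<in>supp p. supp (g b))"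
proof
  fix c assume "c \<in> supp (lin_ext g p)"
  then have "(\<Sum>b\<in>supp p. coeff p b * coeff (g b) c) \<noteq> 0"
    by (simp add: in_keys_iff coeff_lin_ext)
  then obtain b where "b \<in> supp p" "coeff p b * coeff (g b) c \<noteq> 0"
    by (meson sum.neutral)
  then show "c \<in> (\<Union>b\<in>supp p. supp (g b))"
    by (auto simp: in_keys_iff)
qed

lemma supp_scale: "supp (scale c p) \<subseteq> supp p"
  by (auto simp: in_keys_iff)

lemma supp_diff: "supp (p - q) \<subseteq> supp p \<union> supp q"
  by (auto simp: in_keys_iff lookup_minus)

lemma supp_bilin_ext: "supp (bilin_ext m p q) \<subseteq> (\<lambda>(a, b). m a b) ` (supp p \<times> supp q)"
proof -
  have *: "supp (lin_ext (\<lambda>b. basis (m a b)) q) \<subseteq> m a ` supp q" for a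
    using supp_lin_ext[of "\<lambda>b. basis (m a b)" q] by auto
  have "supp (bilin_ext m p q) \<subseteq> (\<Union>a\<in>supp p. m a ` supp q)"
    unfolding bilin_ext_def by (rule order.trans[OF supp_lin_ext UN_mono[OF subset_refl *]])
  then show ?thesis by auto
qed

lemma coeff_bilin_ext_unique:
  assumes "\<And>a b. a \<in> supp p \<Longrightarrow> b \<in> supp q \<Longrightarrow> m a b = c \<longleftrightarrow> a = a0 \<and> b = b0"
  shows "coeff (bilin_ext m p q) c = coeff p a0 * coeff q b0"
proof -
  have inner: "coeff (lin_ext (\<lambda>b. basis (m a b)) q) c = (if a = a0 then coeff q b0 else 0)"
    if "a \<in> supp p" for a
  proof -
    have "coeff (lin_ext (\<lambda>b. basis (m a b)) q) c =
        (\<Sum>b\<in>supp q. if b = b0 then (if a = a0 then coeff q b else 0) else 0)"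
      unfolding coeff_lin_ext by (intro sum.cong) (auto simp: coeff_basis assms that)
    then show ?thesis by (auto simp: in_keys_iff)
  qed
  have "coeff (bilin_ext m p q) c = (\<Sum>a\<in>supp p. if a = a0 then coeff p a * coeff q b0 else 0)"
    unfolding bilin_ext_def coeff_lin_ext[of _ p] by (intro sum.cong) (auto simp: inner)
  then show ?thesis by (auto simp: in_keys_iff)
qed

lemma bilinear_eq_on_basis:
  fixes F G :: "('a \<Rightarrow>\<^sub>0 'k::field) \<Rightarrow> ('b \<Rightarrow>\<^sub>0 'k) \<Rightarrow> ('c \<Rightarrow>\<^sub>0 'k)"
  assumes "\<And>q. lin (\<lambda>p. F p q)" "\<And>p. lin (F p)" "\<And>q. lin (\<lambda>p. G p q)" "\<And>p. lin (G p)"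
    and "\<And>a b. F (basis a) (basis b) = G (basis a) (basis b)"
  shows "F p q = G p q"
proof -
  have "F (basis a) q = G (basis a) q" for a
    by (rule linear_eq_on_basis[OF assms(2,4,5)])
  from linear_eq_on_basis[OF assms(1,3) this] show ?thesis .
qed

text \<open>The semisimple operator with eigenvalue \<open>w b\<close> on \<open>b\<close>. In characteristic \<open>0\<close> its
  eigenvectors are the homogeneous elements, so that homogeneity passes through every injective
  map that intertwines two such operators.\<close>

definition euler :: "('b \<Rightarrow> nat) \<Rightarrow> ('b \<Rightarrow>\<^sub>0 'k::field) \<Rightarrow> ('b \<Rightarrow>\<^sub>0 'k)"
  where "euler w = lin_ext (\<lambda>b. scale (of_nat (w b)) (basis b))"

lemma lin_euler: "lin (euler w)"
  unfolding euler_def by (rule linear_lin_ext)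

lemma euler_basis [simp]: "euler w (basis b) = scale (of_nat (w b)) (basis b)"
  by (simp add: euler_def)

lemma coeff_euler: "coeff (euler w p) b = of_nat (w b) * coeff p b"
proof -
  have "coeff (euler w p) b = (\<Sum>a\<in>supp p. if a = b then of_nat (w a) * coeff p a else 0)"
    unfolding euler_def coeff_lin_ext
    by (intro sum.cong) (auto simp: coeff_basis)
  then show ?thesis
    by (auto simp: in_keys_iff)
qed

lemma euler_eigenvector_iff:
  fixes p :: "'b \<Rightarrow>\<^sub>0 'k::field_char_0"
  shows "euler w p = scale (of_nat n) p \<longleftrightarrow> supp p \<subseteq> {b. w b = n}"
proof
  assume eq: "euler w p = scale (of_nat n) p"
  show "supp p \<subseteq> {b. w b = n}"
  proof clarify
    fix b assume "b \<in> supp p"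
    moreover have "of_nat (w b) * coeff p b = of_nat n * coeff p b"
      using arg_cong[OF eq, of "\<lambda>p. coeff p b"] by (simp add: coeff_euler)
    ultimately show "w b = n"
      by (simp add: in_keys_iff)
  qed
next
  assume "supp p \<subseteq> {b. w b = n}"
  then have "of_nat (w b) * coeff p b = of_nat n * coeff p b" for b
    by (cases "b \<in> supp p") (auto simp: in_keys_iff)
  then show "euler w p = scale (of_nat n) p"
    by (auto intro!: poly_mapping_eqI simp: coeff_euler)
qed

lemma euler_commute:
  fixes f :: "('b \<Rightarrow>\<^sub>0 'k::field_char_0) \<Rightarrow> ('c \<Rightarrow>\<^sub>0 'k)"
  assumes "lin f" "\<And>b. supp (f (basis b)) \<subseteq> {c. w' c = w b}"
  shows "euler w' (f p) = f (euler w p)"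
proof (rule linear_eq_on_basis[where f = "\<lambda>p. euler w' (f p)" and g = "\<lambda>p. f (euler w p)"])
  show "euler w' (f (basis b)) = f (euler w (basis b))" for b
    using assms(2)[of b] by (simp add: lin_scale[OF assms(1)] euler_eigenvector_iff)
qed (rule linear_comp[OF lin_euler assms(1)], rule linear_comp[OF assms(1) lin_euler])

text \<open>A map is unitriangular with respect to \<open>rank\<close> if it sends \<open>b\<close> to \<open>\<tau> b\<close> plus terms
  \<open>\<tau> c\<close> of smaller rank, plus anything outside the range of \<open>\<tau>\<close>. Modulo the
  latter it can be inverted by descending through the ranks.\<close>

locale unitriangular =
  fixes f :: "('b \<Rightarrow>\<^sub>0 'k::field) \<Rightarrow> ('c \<Rightarrow>\<^sub>0 'k)" and \<tau> :: "'b \<Rightarrow> 'c" and rank :: "'b \<Rightarrow> nat"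
  assumes lin: "lin f" and inj: "inj \<tau>"
    and triangular: "rank u \<le> rank v \<Longrightarrow> coeff (f (basis u)) (\<tau> v) = (if u = v then 1 else 0)"
begin

lemma coeff_top:
  assumes "\<And>u. u \<in> supp p \<Longrightarrow> rank u \<le> rank v"
  shows "coeff (f p) (\<tau> v) = coeff p v"
proof -
  have "coeff (f p) (\<tau> v) = (\<Sum>u\<in>supp p. coeff p u * coeff (f (basis u)) (\<tau> v))"
    by (subst lin_as_lin_ext[OF lin]) (rule coeff_lin_ext)
  also have "\<dots> = (\<Sum>u\<in>supp p. if u = v then coeff p u else 0)"
    by (intro sum.cong) (auto simp: triangular assms)
  finally show ?thesis
    by (auto simp: in_keys_iff)
qed

lemma eq_0_if_coeffs_eq_0:
  assumes "\<And>v. coeff (f p) (\<tau> v) = 0"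
  shows "p = 0"
proof (rule ccontr)
  assume "p \<noteq> 0"
  then have ne: "rank ` supp p \<noteq> {}" by simp
  then obtain v where v: "v \<in> supp p" "rank v = Max (rank ` supp p)"
    by (metis (no_types, lifting) Max_in finite_imageI finite_keys imageE)
  then have "coeff (f p) (\<tau> v) = coeff p v"
    by (intro coeff_top) simp
  with v assms show False
    by (simp add: in_keys_iff)
qed

lemma coeffs_attained: "\<exists>p. \<forall>v. coeff (f p) (\<tau> v) = coeff q (\<tau> v)"
proof -
  have bounded: "\<exists>p. \<forall>v. coeff (f p) (\<tau> v) = coeff q (\<tau> v)"
    if "\<And>v. n \<le> rank v \<Longrightarrow> coeff q (\<tau> v) = 0" for n q
    using that
  proof (induction n arbitrary: q)
    case 0
    then show ?case by (intro exI[of _ 0]) (simp add: lin_zero[OF lin])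
  next
    case (Suc n)
    define V where "V = {v. rank v = n \<and> coeff q (\<tau> v) \<noteq> 0}"
    define p0 where "p0 = (\<Sum>v\<in>V. scale (coeff q (\<tau> v)) (basis v))"
    have "\<tau> ` V \<subseteq> supp q"
      by (auto simp: V_def in_keys_iff)
    then have "finite V"
      using inj by (meson finite_imageD finite_keys finite_subset inj_on_subset subset_UNIV)
    then have p0: "coeff p0 v = (if v \<in> V then coeff q (\<tau> v) else 0)" for v
      by (simp add: p0_def lookup_sum coeff_basis if_distrib cong: if_cong)
    have "coeff (q - f p0) (\<tau> v) = 0" if "n \<le> rank v" for v
    proof -
      have "coeff (f p0) (\<tau> v) = coeff p0 v"
        by (rule coeff_top) (use that in \<open>auto simp: in_keys_iff p0 V_def split: if_splits\<close>)
      then show ?thesis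
        using Suc.prems[of v] that by (auto simp: lookup_minus p0 V_def)
    qed
    from Suc.IH[OF this] obtain p where "coeff (f p) (\<tau> v) = coeff (q - f p0) (\<tau> v)" for v
      by blast
    then show ?case
      by (intro exI[of _ "p + p0"]) (simp add: lin_add[OF lin] lookup_add lookup_minus)
  qed
  have "finite (\<tau> -` supp q)"
    using inj by (simp add: finite_vimageI)
  then obtain n where "\<And>v. v \<in> \<tau> -` supp q \<Longrightarrow> rank v < n"
    by (metis finite_imageI finite_nat_set_iff_bounded imageI)
  then show ?thesis
    by (intro bounded[of n]) (force simp: in_keys_iff)
qed

end

section \<open>Tensor products\<close>

lemma lin_tensor_left: "lin (\<lambda>p. tensor p q)"
  and lin_tensor_right: "lin (tensor p)"
  unfolding tensor_def by (rule linear_bilin_ext_left linear_bilin_ext_right)+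

lemma lin_fmul_left: "lin (\<lambda>p. fmul p q)"
  and lin_fmul_right: "lin (fmul p)"
  unfolding fmul_def by (rule linear_bilin_ext_left linear_bilin_ext_right)+

lemma lin_tmul_left: "lin (\<lambda>p. tmul p q)"
  and lin_tmul_right: "lin (tmul p)"
  unfolding tmul_def by (rule linear_bilin_ext_left linear_bilin_ext_right)+

lemma lin_tensor_map: "lin (tensor_map f g)"
  unfolding tensor_map_def by (rule linear_lin_ext)

lemma fmul_basis [simp]: "fmul (basis u) (basis v) = basis (umul u v)"
  by (simp add: fmul_def)

lemma tensor_basis [simp]: "tensor (basis a) (basis b) = basis (a, b)"
  by (simp add: tensor_def)

lemmas lin_intros =
  linear_id_scale linear_comp[OF lin_tensor_left] linear_comp[OF lin_tensor_right]
  linear_comp[OF lin_fmul_left] linear_comp[OF lin_fmul_right]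
  linear_comp[OF lin_tmul_left] linear_comp[OF lin_tmul_right]
  linear_comp[OF lin_tensor_map] linear_comp[OF lin_euler] linear_comp[OF lin_scaled]
  linear_plus lin_minus linear_lin_ext

lemma tensor_map_basis: "tensor_map f g (basis (a, b)) = tensor (f (basis a)) (g (basis b))"
  by (simp add: tensor_map_def)

lemmas lin_simps = lin_zero lin_add lin_diff lin_scale

lemmas fmul_linear =
  lin_simps[OF lin_fmul_left] lin_simps[OF lin_fmul_right]

lemmas tmul_linear =
  lin_simps[OF lin_tmul_left] lin_simps[OF lin_tmul_right]

lemmas tensor_linear =
  lin_simps[OF lin_tensor_left] lin_simps[OF lin_tensor_right]

lemma coeff_tensor: "coeff (tensor p q) (a, b) = coeff p a * coeff q b"
  unfolding tensor_def by (rule coeff_bilin_ext_unique) simp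

lemma supp_tensor: "supp (tensor p q) = supp p \<times> supp q"
  by (auto simp: in_keys_iff coeff_tensor)

lemma tensor_map_tensor:
  assumes "lin f" "lin g"
  shows "tensor_map f g (tensor p q) = tensor (f p) (g q)"
  by (rule bilinear_eq_on_basis[where F = "\<lambda>p q. tensor_map f g (tensor p q)"
        and G = "\<lambda>p q. tensor (f p) (g q)"])
    ((rule lin_intros assms)+, simp add: tensor_map_basis)

lemma tensor_map_comp:
  assumes "lin f" "lin g"
  shows "tensor_map f g (tensor_map f' g' t) = tensor_map (\<lambda>p. f (f' p)) (\<lambda>p. g (g' p)) t"
proof (rule linear_eq_on_basis[where f = "\<lambda>t. tensor_map f g (tensor_map f' g' t)"])
  show "tensor_map f g (tensor_map f' g' (basis b)) =
      tensor_map (\<lambda>p. f (f' p)) (\<lambda>p. g (g' p)) (basis b)" for b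
    by (cases b) (simp add: tensor_map_basis tensor_map_tensor assms)
qed (rule lin_intros)+

lemma tensor_map_id: "tensor_map (\<lambda>p. p) (\<lambda>p. p) t = t"
  by (rule linear_eq_on_basis[OF lin_tensor_map linear_id_scale]) (auto simp: tensor_map_basis)

lemma tmul_tensor: "tmul (tensor a b) (tensor c d) = tensor (fmul a c) (fmul b d)"
proof -
  have 1: "tmul (basis (u, v)) (tensor c d) = tensor (fmul (basis u) c) (fmul (basis v) d)" for u v
    by (rule bilinear_eq_on_basis[where F = "\<lambda>c d. tmul (basis (u, v)) (tensor c d)"
          and G = "\<lambda>c d. tensor (fmul (basis u) c) (fmul (basis v) d)"])
      ((rule lin_intros)+, simp add: tmul_def)
  show ?thesis
    by (rule bilinear_eq_on_basis[where F = "\<lambda>a b. tmul (tensor a b) (tensor c d)"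
          and G = "\<lambda>a b. tensor (fmul a c) (fmul b d)"])
      ((rule lin_intros)+, simp add: 1)
qed

lemma alg_homD:
  assumes "alg_hom mul one mul' one' f"
  shows "lin f" "f one = one'" "f (mul p q) = mul' (f p) (f q)"
  using assms by (auto simp: alg_hom_def)

lemma tensor_map_alg_hom:
  fixes f :: "('a, 'b::field) free_alg \<Rightarrow> ('c, 'b) free_alg"
  assumes f: "alg_hom fmul fone fmul fone f"
  shows "alg_hom tmul tone tmul tone (tensor_map f f)"
proof -
  note lin = alg_homD(1)[OF f]
  have "tensor_map f f (tmul s t) = tmul (tensor_map f f s) (tensor_map f f t)" for s t
  proof (rule bilinear_eq_on_basis[where F = "\<lambda>s t. tensor_map f f (tmul s t)"
        and G = "\<lambda>s t. tmul (tensor_map f f s) (tensor_map f f t)"])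
    fix s t :: "'a magma option \<times> 'a magma option"
    obtain a b c d where st: "s = (a, b)" "t = (c, d)" by (cases s, cases t) auto
    have st: "(basis s :: ('a, 'b) free_alg2) = tensor (basis a) (basis b)"
      "(basis t :: ('a, 'b) free_alg2) = tensor (basis c) (basis d)"
      by (simp_all add: st)
    show "tensor_map f f (tmul (basis s) (basis t)) =
        tmul (tensor_map f f (basis s)) (tensor_map f f (basis t))"
      unfolding st tmul_tensor tensor_map_tensor[OF lin lin] alg_homD(3)[OF f] ..
  qed (rule lin_intros)+
  moreover have "tensor_map f f tone = tone"
    unfolding tone_def by (simp add: tensor_map_tensor lin alg_homD(2)[OF f])
  ultimately show ?thesis
    by (simp add: alg_hom_def lin_tensor_map)
qed

lemma alg_hom_comp:
  assumes "alg_hom mul2 one2 mul3 one3 g" "alg_hom mul1 one1 mul2 one2 f"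
  shows "alg_hom mul1 one1 mul3 one3 (\<lambda>p. g (f p))"
  using assms linear_comp[of g f] by (simp add: alg_hom_def)

section \<open>The constants as a complement of the right multiples of \<open>x\<close>\<close>

lemma leaves_pos: "0 < leaves t"
  by (induction t) auto

lemma deg_umul: "deg (umul u v) = deg u + deg v"
  by (cases u; cases v) auto

lemma deg_eq_0_iff [simp]: "deg u = 0 \<longleftrightarrow> u = None"
  using leaves_pos by (cases u) auto

lemma deg_pos: "u \<noteq> None \<Longrightarrow> 0 < deg u"
  by (metis deg_eq_0_iff gr0I)

lemma umul_eq_None_iff [simp]: "umul u v = None \<longleftrightarrow> u = None \<and> v = None"
  by (cases u; cases v) auto

lemma supp_fmul_graded:
  assumes "\<And>u v. w (umul u v) = w u + w v" "supp p \<subseteq> {u. w u = m}" "supp q \<subseteq> {u. w u = n}"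
  shows "supp (fmul p q) \<subseteq> {u. w u = m + (n::nat)}"
  using supp_bilin_ext[of umul p q] assms unfolding fmul_def by fastforce

lemma coeff_fmul_None: "coeff (fmul p q) None = coeff p None * coeff q None"
  unfolding fmul_def by (rule coeff_bilin_ext_unique) simp

lemma coeff_fmul_Node:
  assumes "coeff p None = 0" "coeff q None = 0"
  shows "coeff (fmul p q) (Some (Node s t)) = coeff p (Some s) * coeff q (Some t)"
  unfolding fmul_def
proof (rule coeff_bilin_ext_unique)
  fix a b assume "a \<in> supp p" "b \<in> supp q"
  with assms have "a \<noteq> None" "b \<noteq> None"
    by (metis in_keys_iff)+
  then show "umul a b = Some (Node s t) \<longleftrightarrow> a = Some s \<and> b = Some t"
    by auto
qed

lemma supp_ddx_basis: "supp (ddx (basis u :: (unit, 'k::field) free_alg)) \<subseteq> {v. deg v + 1 = deg u}"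
proof -
  have "supp (ddx_magma t :: (unit, 'k) free_alg) \<subseteq> {v. deg v + 1 = leaves t}" for t
  proof (induction t)
    case (Node s t)
    have b: "supp (basis (Some t) :: (unit, 'k) free_alg) \<subseteq> {v. deg v = leaves t}" for t
      by simp
    have "supp (ddx_magma t :: (unit, 'k) free_alg) \<subseteq> {v. deg v = leaves t - 1}"
      "supp (ddx_magma s :: (unit, 'k) free_alg) \<subseteq> {v. deg v = leaves s - 1}"
      using Node by auto
    from supp_fmul_graded[OF deg_umul this(2) b[of t]] supp_fmul_graded[OF deg_umul b[of s] this(1)]
    show ?case
      using leaves_pos[of s] leaves_pos[of t]
        Poly_Mapping.keys_add[of "fmul (ddx_magma s) (basis (Some t))"
          "fmul (basis (Some s)) (ddx_magma t) :: (unit, 'k) free_alg"]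
      by fastforce
  qed (simp add: fone_def)
  then show ?thesis
    by (cases u) (auto simp: ddx_def)
qed

lemma ddx_fone: "ddx fone = 0"
  by (simp add: ddx_def fone_def)

lemma ddx_funpow_linear: "lin (ddx ^^ n)"
  by (induction n) (auto simp: o_def intro: linear_comp[OF linear_ddx] linear_id_scale)

lemma ddx_nilpotent:
  fixes f :: "(unit, 'k::field) free_alg"
  shows "\<exists>n. (ddx ^^ n) f = 0"
proof -
  have *: "(ddx ^^ n) f = 0" if "supp f \<subseteq> {u. deg u < n}" for n and f :: "(unit, 'k) free_alg"
    using that
  proof (induction n arbitrary: f)
    case (Suc n)
    have "supp (ddx f) \<subseteq> (\<Union>b\<in>supp f. supp (ddx (basis b) :: (unit, 'k) free_alg))"
      by (subst lin_as_lin_ext[OF linear_ddx]) (rule supp_lin_ext)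
    with Suc.prems supp_ddx_basis have "supp (ddx f) \<subseteq> {u. deg u < n}"
      by fastforce
    from Suc.IH[OF this] show ?case
      by (simp add: funpow_swap1)
  qed simp
  have "finite (deg ` supp f)" by simp
  then obtain n where "\<forall>d\<in>deg ` supp f. d < n"
    by (metis finite_nat_set_iff_bounded)
  then have "supp f \<subseteq> {u. deg u < n}" by auto
  from *[OF this] show ?thesis ..
qed

abbreviation times_x :: "(unit, 'k::field) free_alg \<Rightarrow> (unit, 'k) free_alg"
  where "times_x g \<equiv> fmul g (gen ())"

text \<open>This is the defining relation of the Weyl algebra; the two rules after it are its usual
  consequences for powers.\<close>

lemma ddx_times_x: "ddx (times_x g) = times_x (ddx g) + g"
  by (simp add: ddx_fmul ddx_gen fone_unit)

lemma ddx_funpow_times_x: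
  "(ddx ^^ k) (times_x g) = times_x ((ddx ^^ k) g) + scale (of_nat k) ((ddx ^^ (k - 1)) g)"
proof (induction k)
  case (Suc k)
  have "scale (of_nat k) (ddx ((ddx ^^ (k - 1)) g)) = scale (of_nat k) ((ddx ^^ k) g)"
    by (cases k) simp_all
  with Suc show ?case
    by (simp add: lin_add[OF linear_ddx] lin_scale[OF linear_ddx] ddx_times_x scale_distribs
        algebra_simps)
qed simp

lemma ddx_times_x_funpow:
  "ddx ((times_x ^^ Suc k) f) = (times_x ^^ Suc k) (ddx f) + scale (of_nat (Suc k)) ((times_x ^^ k) f)"
proof (induction k)
  case (Suc k)
  show ?case
    by (subst funpow.simps, subst o_apply, subst ddx_times_x, subst Suc.IH)
      (auto intro!: poly_mapping_eqI simp: fmul_linear lookup_add algebra_simps)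
qed (simp add: ddx_times_x)

text \<open>Given the Weyl relation, \<open>f \<mapsto> (f x)'\<close> is the identity plus a number operator, hence
  bijective in characteristic \<open>0\<close>: a preimage arises from iterated integration by parts.\<close>

lemma bij_ddx_times_x: "bij (\<lambda>g :: (unit, 'k::field_char_0) free_alg. ddx (times_x g))"
proof (rule bijI)
  let ?S = "\<lambda>g :: (unit, 'k) free_alg. ddx (times_x g)"
  have lin: "lin ?S"
    by (rule linear_comp[OF linear_ddx lin_fmul_left])
  have ker: "g = 0" if "?S g = 0" for g
  proof -
    \<comment> \<open>Hence if a derivative of \<open>g\<close> vanishes, so does the previous one.\<close>
    have *: "scale (of_nat (Suc k)) ((ddx ^^ k) g) = - times_x ((ddx ^^ Suc k) g)" for k
    proof -
      have "(ddx ^^ k) (?S g) = 0"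
        using that lin_zero[OF ddx_funpow_linear] by simp
      then have "(ddx ^^ Suc k) (times_x g) = 0"
        by (simp add: funpow_swap1)
      then show ?thesis
        unfolding ddx_funpow_times_x by (simp add: eq_neg_iff_add_eq_0 add.commute)
    qed
    have "g = 0" if "(ddx ^^ n) g = 0" for n
      using that
    proof (induction n)
      case (Suc n)
      then have "scale (of_nat (Suc n)) ((ddx ^^ n) g) = 0"
        by (simp only: *) (simp add: fmul_linear)
      then have "scale (inverse (of_nat (Suc n))) (scale (of_nat (Suc n)) ((ddx ^^ n) g)) = 0"
        by simp
      then show ?case
        by (intro Suc.IH) (simp del: of_nat_Suc)
    qed simp
    then show ?thesis
      using ddx_nilpotent by blast
  qed
  show "inj ?S"
    by (rule injI) (metis ker lin_diff[OF lin] right_minus_eq)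
  \<comment> \<open>With \<open>f x\<^sup>k\<close> in place of \<open>f\<close>, integration by parts trades a derivative of \<open>f\<close> for a
    power of \<open>x\<close>.\<close>
  have "\<exists>g. ?S g = (times_x ^^ k) f" if "(ddx ^^ n) f = 0" for n k and f :: "(unit, 'k) free_alg"
    using that
  proof (induction n arbitrary: f k)
    case 0
    have "(times_x ^^ k) (0 :: (unit, 'k) free_alg) = 0"
      by (induction k) (simp_all add: fmul_linear)
    with 0 show ?case
      by (intro exI[of _ 0]) (simp add: lin_zero[OF lin])
  next
    case (Suc n)
    then obtain g where g: "?S g = (times_x ^^ Suc k) (ddx f)"
      by (metis comp_apply funpow_Suc_right)
    have "?S (scale (inverse (of_nat (Suc k))) ((times_x ^^ k) f - g)) = (times_x ^^ k) f"
      using ddx_times_x_funpow[of k f] by (simp add: lin_scale[OF lin] lin_diff[OF lin] g del: of_nat_Suc)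
    then show ?case ..
  qed
  from this[where k = 0] ddx_nilpotent show "surj ?S"
    unfolding surj_def by (metis funpow_0)
qed

text \<open>The projection to the constants along the right multiples of \<open>x\<close>.\<close>

definition const_part :: "(unit, 'k::field_char_0) free_alg \<Rightarrow> (unit, 'k) free_alg"
  where "const_part f = f - times_x (inv (\<lambda>g. ddx (times_x g)) (ddx f))"

lemma lin_inv_ddx_times_x: "lin (inv (\<lambda>g :: (unit, 'k::field_char_0) free_alg. ddx (times_x g)))"
  by (rule lin_inv[OF linear_comp[OF linear_ddx lin_fmul_left] bij_ddx_times_x])

lemma lin_const_part: "lin const_part"
  unfolding const_part_def by (rule lin_intros linear_comp[OF lin_inv_ddx_times_x] linear_ddx)+

lemma const_part_constant: "const_part f \<in> constants"
  unfolding constants_def const_part_def mem_Collect_eq lin_diff[OF linear_ddx]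
  using surj_f_inv_f[OF bij_is_surj[OF bij_ddx_times_x], of "ddx f"] by simp

lemma const_part_of_constant: "c \<in> constants \<Longrightarrow> const_part c = c"
  by (simp add: constants_def const_part_def lin_zero[OF lin_inv_ddx_times_x] fmul_linear)

lemma constant_times_x_eq_0:
  fixes g :: "(unit, 'k::field_char_0) free_alg"
  assumes "times_x g \<in> constants"
  shows "g = 0"
  by (rule injD[OF bij_is_inj[OF bij_ddx_times_x]])
    (use assms in \<open>simp add: constants_def fmul_linear lin_zero[OF linear_ddx]\<close>)

lemma times_x_basis: "times_x (basis u) = basis (umul u (Some (Leaf ())))"
  by (simp add: gen_def)

text \<open>The defect \<open>deg (const_part p) - n \<cdot> const_part p\<close>, with the grading operator \<open>deg\<close>, is
  both a constant and a right multiple of \<open>x\<close>.\<close>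

lemma const_part_graded:
  fixes p :: "(unit, 'k::field_char_0) free_alg"
  assumes "supp p \<subseteq> {u. deg u = n}"
  shows "supp (const_part p) \<subseteq> {u. deg u = n}"
proof -
  have euler_x: "euler deg (times_x g) = times_x (euler (\<lambda>u. deg u + 1) g)"
    for g :: "(unit, 'k) free_alg"
    by (rule euler_commute[OF lin_fmul_left]) (simp add: times_x_basis deg_umul)
  have euler_ddx: "euler (\<lambda>u. deg u + 1) (ddx g) = ddx (euler deg g)" for g :: "(unit, 'k) free_alg"
    by (rule euler_commute[OF linear_ddx supp_ddx_basis])
  define d where "d = euler deg (const_part p) - scale (of_nat n) (const_part p)"
  have "ddx d = 0"
    using const_part_constant[of p] unfolding d_def constants_def
    by (simp add: lin_diff[OF linear_ddx] lin_scale[OF linear_ddx] lin_zero[OF lin_euler] flip: euler_ddx)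
  moreover have "\<exists>g. d = times_x g"
  proof -
    obtain g where g: "const_part p = p - times_x g"
      unfolding const_part_def by blast
    have "euler deg p = scale (of_nat n) p"
      using assms by (simp add: euler_eigenvector_iff)
    then show ?thesis
      unfolding d_def g
      by (intro exI[of _ "scale (of_nat n) g - euler (\<lambda>u. deg u + 1) g"])
        (simp add: lin_diff[OF lin_euler] euler_x scale_distribs fmul_linear)
  qed
  ultimately have "d = 0"
    using constant_times_x_eq_0 unfolding constants_def by (metis mem_Collect_eq fmul_linear(1))
  then show ?thesis
    by (simp add: d_def flip: euler_eigenvector_iff)
qed

section \<open>Free generators of the algebra of constants\<close>

text \<open>By the decomposition above, a constant is determined by its coefficients at \<open>1\<close> and at
  the trees that do not end in \<open>x\<close>, and these coefficients are arbitrary.\<close>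

primrec normal :: "'x magma \<Rightarrow> bool"
  where
    "normal (Leaf x) \<longleftrightarrow> False"
  | "normal (Node s t) \<longleftrightarrow> (\<nexists>x. t = Leaf x)"

lemma normal_Node: "normal t \<Longrightarrow> normal (Node s t)"
  by auto

lemma constant_eq_0_if_coeffs_eq_0:
  fixes c :: "(unit, 'k::field_char_0) free_alg"
  assumes c: "c \<in> constants" and none: "coeff c None = 0" and normal: "\<And>t. normal t \<Longrightarrow> coeff c (Some t) = 0"
  shows "c = 0"
proof -
  define strip :: "unit magma option \<Rightarrow> unit magma option"
    where "strip u = (case u of Some (Node s t) \<Rightarrow> Some s | _ \<Rightarrow> None)" for u
  have ends: "umul (strip u) (Some (Leaf ())) = u" if "u \<in> supp c" for u
  proof -
    from that obtain t where t: "u = Some t"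
      using none by (cases u) (auto simp: in_keys_iff)
    with that normal have "\<not> normal t"
      by (auto simp: in_keys_iff)
    then show ?thesis
      by (cases t) (auto simp: strip_def t)
  qed
  have "times_x (lin_ext (\<lambda>u. basis (strip u)) c) = lin_ext (\<lambda>u. times_x (basis (strip u))) c"
    by (rule lin_lin_ext[OF lin_fmul_left])
  also have "\<dots> = lin_ext basis c"
    by (rule lin_ext_cong) (simp add: times_x_basis ends)
  finally have "times_x (lin_ext (\<lambda>u. basis (strip u)) c) = c"
    by (simp add: lin_ext_basis_id)
  with constant_times_x_eq_0 c show ?thesis
    by (metis fmul_linear(1))
qed

lemma coeff_const_part_normal:
  assumes "normal t"
  shows "coeff (const_part p) (Some t) = coeff p (Some t)"
proof -
  have "coeff (times_x g) (Some t) = 0" for g :: "(unit, 'k::field) free_alg"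
  proof -
    have "supp (times_x g) \<subseteq> (\<lambda>u. umul u (Some (Leaf ()))) ` supp g"
      using supp_bilin_ext[of umul g "gen ()"] by (auto simp: fmul_def gen_def)
    moreover have "Some t \<noteq> umul u (Some (Leaf ()))" for u
      using assms by (cases u) auto
    ultimately have "Some t \<notin> supp (times_x g)" by blast
    then show ?thesis by (simp add: in_keys_iff)
  qed
  then show ?thesis
    by (simp add: const_part_def lookup_minus)
qed

text \<open>The normal trees form a free magma on those normal trees that are not a product of two
  normal ones.\<close>

definition indecomposable :: "'x magma \<Rightarrow> bool"
  where "indecomposable t \<longleftrightarrow> normal t \<and> (\<nexists>a b. normal a \<and> normal b \<and> t = Node a b)"

lemma normal_magma_eval:
  assumes "\<And>i. indecomposable (e i)"
  shows "normal (magma_eval Node e v)"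
  by (induction v) (use assms in \<open>auto simp: indecomposable_def intro: normal_Node simp del: normal.simps\<close>)

lemma inj_magma_eval_Node:
  assumes "inj e" and e: "\<And>i. indecomposable (e i)"
  shows "inj (magma_eval Node e)"
proof (rule injI)
  have leaf: "e i \<noteq> magma_eval Node e (Node s t)" for i s t
    using e[of i] normal_magma_eval[of e] e by (auto simp: indecomposable_def)
  show "u = v" if "magma_eval Node e u = magma_eval Node e v" for u v
    using that
  proof (induction u arbitrary: v)
    case (Leaf i)
    then show ?case
      using leaf[of i] \<open>inj e\<close> by (cases v) (auto simp: inj_eq)
  next
    case (Node s t)
    then show ?case
      using leaf[of _ s t] by (cases v) (auto simp del: magma_eval.simps(2), auto)
  qed
qed

lemma normal_in_range_magma_eval:
  assumes "range e = {t. indecomposable t}" "normal t"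
  shows "t \<in> range (magma_eval Node e)"
  using \<open>normal t\<close>
proof (induction t)
  case (Node s t)
  show ?case
  proof (cases "indecomposable (Node s t)")
    case True
    then obtain i where "Node s t = e i"
      using assms(1) by auto
    then show ?thesis
      by (metis magma_eval.simps(1) rangeI)
  next
    case False
    with Node.prems have "normal s" "normal t"
      by (auto simp: indecomposable_def)
    with Node.IH obtain u v where "s = magma_eval Node e u" "t = magma_eval Node e v"
      by blast
    then show ?thesis
      by (metis magma_eval.simps(2) rangeI)
  qed
qed simp

primrec magma_weight :: "('x \<Rightarrow> nat) \<Rightarrow> 'x magma \<Rightarrow> nat"
  where
    "magma_weight d (Leaf x) = d x"
  | "magma_weight d (Node s t) = magma_weight d s + magma_weight d t"

definition weight :: "('x \<Rightarrow> nat) \<Rightarrow> 'x magma option \<Rightarrow> nat"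
  where "weight d = case_option 0 (magma_weight d)"

lemma weight_simps [simp]:
  "weight d None = 0" "weight d (Some (Leaf x)) = d x"
  "weight d (Some (Node s t)) = weight d (Some s) + weight d (Some t)"
  by (simp_all add: weight_def)

lemma weight_umul: "weight d (umul u v) = weight d u + weight d v"
  by (cases u; cases v) auto

lemma weight_pos:
  assumes "\<And>i. 0 < d i" "u \<noteq> None"
  shows "0 < weight d u"
proof -
  have "0 < magma_weight d t" for t
    using assms(1) by (induction t) auto
  then show ?thesis using assms(2) by (cases u) (auto simp: weight_def)
qed

lemma fsubst_basis:
  "fsubst h (basis None) = fone" "fsubst h (basis (Some t)) = magma_eval fmul h t"
  by (simp_all add: subst_def)

lemma coeff_fone: "coeff fone u = (if u = None then 1 else 0)"
  by (auto simp: fone_def coeff_basis)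

lemma lin_fsubst: "lin (fsubst h)"
  by (rule alg_homD(1)[OF alg_hom_fsubst])

lemma fsubst_graded:
  assumes w: "\<And>u v. w (umul u v) = w u + w v" "w None = 0"
    and h: "\<And>i. supp (h i) \<subseteq> {u. w u = d i}"
  shows "supp (fsubst h (basis u)) \<subseteq> {v. w v = weight d u}"
proof (cases u)
  case (Some t)
  have "supp (magma_eval fmul h t) \<subseteq> {v. w v = weight d (Some t)}"
  proof (induction t)
    case (Node s t)
    from supp_fmul_graded[OF w(1) Node.IH] show ?case by simp
  qed (use h in simp)
  with Some show ?thesis
    by (simp only: fsubst_basis)
qed (auto simp: fsubst_basis coeff_fone in_keys_iff w split: if_splits)

lemma fsubst_constant:
  assumes "\<And>i. y i \<in> constants"
  shows "fsubst y p \<in> constants"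
proof -
  have "ddx (magma_eval fmul y t) = 0" for t
    by (induction t) (use assms in \<open>simp_all add: constants_def ddx_fmul fmul_linear\<close>)
  then have "ddx (fsubst y (basis u)) = 0" for u
    by (cases u) (simp_all only: fsubst_basis ddx_fone)
  moreover have "ddx (fsubst y p) = lin_ext (\<lambda>u. ddx (fsubst y (basis u))) p"
    by (rule lin_as_lin_ext[OF linear_comp[OF linear_ddx lin_fsubst]])
  ultimately show ?thesis
    by (simp add: constants_def lin_ext_def)
qed

text \<open>Let \<open>\<tau> v\<close> be the normal tree obtained by grafting the trees \<open>e i\<close> onto \<open>v\<close>. The
  coefficient of a product at \<open>Node a b\<close> is the product of the coefficients of the factors at
  \<open>a\<close> and \<open>b\<close>, so a monomial \<open>u\<close> in the projections of the \<open>e i\<close> has coefficient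
  \<open>1\<close> at \<open>\<tau> u\<close>. Another normal tree occurs in it only if a subproduct contributes an
  indecomposable tree, which replaces several leaves of \<open>u\<close> by a single one; hence it is some
  \<open>\<tau> v\<close> where \<open>v\<close> has fewer leaves than \<open>u\<close>.\<close>

lemma bij_betw_fsubst_const_part:
  fixes e :: "nat \<Rightarrow> unit magma"
  assumes e: "inj e" "range e = {t. indecomposable t}"
  shows "bij_betw (fsubst (\<lambda>i. const_part (basis (Some (e i)) :: (unit, 'k::field_char_0) free_alg)))
    UNIV constants"
proof -
  define y :: "nat \<Rightarrow> (unit, 'k) free_alg" where "y i = const_part (basis (Some (e i)))" for i
  define \<tau> where "\<tau> = magma_eval Node e"
  have ind: "indecomposable (e i)" for i
    using e(2) by auto
  then have norm: "normal (\<tau> v)" for v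
    unfolding \<tau>_def by (rule normal_magma_eval)
  have "inj \<tau>"
    unfolding \<tau>_def using e(1) ind by (rule inj_magma_eval_Node)
  have const: "fsubst y p \<in> constants" for p
    by (rule fsubst_constant) (simp add: y_def const_part_constant)
  have y_None: "coeff (y i) None = 0" for i
  proof -
    have "supp (y i) \<subseteq> {u. deg u = leaves (e i)}"
      unfolding y_def by (rule const_part_graded) simp
    then show ?thesis
      using leaves_pos[of "e i"] by (auto simp: in_keys_iff)
  qed
  have None: "coeff (magma_eval fmul y u) None = 0" for u
    by (induction u) (simp_all add: y_None coeff_fmul_None)
  have tri: "coeff (magma_eval fmul y u) (Some (\<tau> v)) = (if u = v then 1 else 0)"
    if "leaves u \<le> leaves v" for u v
    using that
  proof (induction u arbitrary: v)
    case (Leaf i)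
    have "coeff (y i) (Some (\<tau> v)) = (if e i = \<tau> v then 1 else 0)"
      by (simp add: y_def coeff_const_part_normal norm coeff_basis)
    also have "e i = \<tau> v \<longleftrightarrow> Leaf i = v"
      using \<open>inj \<tau>\<close> inj_eq[of \<tau> "Leaf i" v] by (simp add: \<tau>_def)
    finally show ?case by simp
  next
    case (Node u1 u2)
    show ?case
    proof (cases v)
      case (Leaf j)
      with Node.prems leaves_pos[of u1] leaves_pos[of u2] show ?thesis
        by simp
    next
      case (Node v1 v2)
      have "coeff (magma_eval fmul y (Node u1 u2)) (Some (\<tau> v)) =
          coeff (magma_eval fmul y u1) (Some (\<tau> v1)) * coeff (magma_eval fmul y u2) (Some (\<tau> v2))"
        by (simp add: Node \<tau>_def coeff_fmul_Node None)
      \<comment> \<open>If \<open>u1\<close> has more leaves than \<open>v1\<close>, then \<open>u2\<close> has fewer than \<open>v2\<close> and the second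
        coefficient is \<open>0\<close>; the same holds with the factors exchanged.\<close>
      also have "\<dots> = (if Node u1 u2 = v then 1 else 0)"
      proof (cases "leaves u1 \<le> leaves v1")
        case True
        then show ?thesis
        proof (cases "leaves u2 \<le> leaves v2")
          case False
          with Node.prems \<open>v = _\<close> have "leaves u1 < leaves v1" by simp
          with Node.IH(1)[of v1] show ?thesis
            using \<open>v = _\<close> by auto
        qed (simp add: Node Node.IH)
      next
        case False
        with Node.prems \<open>v = _\<close> have "leaves u2 < leaves v2" by simp
        with Node.IH(2)[of v2] show ?thesis
          using \<open>v = _\<close> by auto
      qed
      finally show ?thesis .
    qed
  qed
  have "unitriangular (fsubst y) (map_option \<tau>) deg"
  proof (rule unitriangular.intro)
    show "inj (map_option \<tau>)"
      using \<open>inj \<tau>\<close> by (rule option.inj_map)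
    show "coeff (fsubst y (basis u)) (map_option \<tau> v) = (if u = v then 1 else 0)"
      if "deg u \<le> deg v" for u v
      using that deg_eq_0_iff[of u]
      by (cases u; cases v) (simp_all add: fsubst_basis coeff_fone None tri)
  qed (rule lin_fsubst)
  then interpret unitriangular "fsubst y" "map_option \<tau>" deg .
  have eq_0: "c = 0" if "c \<in> constants" "\<And>v. coeff c (map_option \<tau> v) = 0" for c :: "(unit, 'k) free_alg"
  proof (rule constant_eq_0_if_coeffs_eq_0[OF that(1)])
    show "coeff c None = 0"
      using that(2)[of None] by simp
    show "coeff c (Some t) = 0" if "normal t" for t
    proof -
      have "t \<in> range \<tau>"
        using normal_in_range_magma_eval[OF e(2) that] by (simp add: \<tau>_def)
      then obtain v where "t = \<tau> v" by blast
      then show ?thesis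
        using \<open>\<And>v. coeff c (map_option \<tau> v) = 0\<close>[of "Some v"] by simp
    qed
  qed
  have "bij_betw (fsubst y) UNIV constants"
    unfolding bij_betw_def
  proof (intro conjI set_eqI iffI)
    show "inj (fsubst y)"
    proof (rule injI)
      fix p q assume "fsubst y p = fsubst y q"
      then have "p - q = 0"
        by (intro eq_0_if_coeffs_eq_0) (simp add: lin_diff[OF lin_fsubst])
      then show "p = q" by simp
    qed
    show "c \<in> constants" if "c \<in> range (fsubst y)" for c
      using that const by auto
    show "c \<in> range (fsubst y)" if c: "c \<in> constants" for c
    proof -
      obtain p where p: "coeff (fsubst y p) (map_option \<tau> v) = coeff c (map_option \<tau> v)" for v
        using coeffs_attained by blast
      have "c - fsubst y p = 0"
        by (rule eq_0) (use c const[of p] in \<open>auto simp: constants_def lin_diff[OF linear_ddx] lookup_minus p\<close>)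
      then show ?thesis by auto
    qed
  qed
  then show ?thesis
    by (simp add: y_def[abs_def])
qed

text \<open>The elements of each size are numbered arbitrarily, with an offset that exceeds all
  numbers used for smaller sizes; the resulting injection into \<open>nat\<close> is monotone in the size.\<close>

lemma enumeration_by_size:
  fixes G :: "'a set" and f :: "'a \<Rightarrow> nat"
  assumes "infinite G" and fin: "\<And>n. finite {x \<in> G. f x = n}"
  shows "\<exists>e :: nat \<Rightarrow> 'a. bij_betw e UNIV G \<and> (\<forall>i. f (e i) \<le> f (e (Suc i)))"
proof -
  have "countable (\<Union>n. {x \<in> G. f x = n})"
    by (intro countable_UN countable_finite fin countableI_type)
  moreover have "(\<Union>n. {x \<in> G. f x = n}) = G" by auto
  ultimately have "countable G" by simp
  then have inj: "inj_on (to_nat_on G) G"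
    by (rule inj_on_to_nat_on)
  define level where "level n = (\<Sum>x | x \<in> G \<and> f x = n. to_nat_on G x)" for n
  define key where "key x = (\<Sum>k<f x. Suc (level k)) + to_nat_on G x" for x
  have key_less: "key x < key z" if "x \<in> G" "z \<in> G" "f x < f z" for x z
  proof -
    have "to_nat_on G x \<le> level (f x)"
      unfolding level_def by (rule member_le_sum) (use that fin in auto)
    then have "key x < (\<Sum>k<Suc (f x). Suc (level k))"
      by (simp add: key_def)
    also have "\<dots> \<le> (\<Sum>k<f z. Suc (level k))"
      by (rule sum_mono2) (use that in auto)
    finally show ?thesis
      by (simp add: key_def)
  qed
  have "inj_on key G"
  proof (rule inj_onI)
    fix x z assume xz: "x \<in> G" "z \<in> G" "key x = key z"
    with key_less have "f x = f z"
      by (metis less_irrefl linorder_neqE_nat)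
    with xz inj show "x = z"
      by (simp add: key_def inj_on_eq_iff)
  qed
  then have bij_key: "bij_betw key G (key ` G)"
    by (simp add: bij_betw_def)
  have inf: "infinite (key ` G)"
    using assms(1) \<open>inj_on key G\<close> by (simp add: finite_image_iff)
  define e where "e = the_inv_into G key \<circ> enumerate (key ` G)"
  have "bij_betw e UNIV G"
    unfolding e_def
    by (rule bij_betw_trans[OF bij_enumerate[OF inf] bij_betw_the_inv_into[OF bij_key]])
  moreover have "f (e i) \<le> f (e (Suc i))" for i
  proof -
    have key: "key (e i) = enumerate (key ` G) i" for i
      unfolding e_def o_apply
      by (rule f_the_inv_into_f[OF \<open>inj_on key G\<close> enumerate_in_set[OF inf]])
    have "e i \<in> G" for i
      using \<open>bij_betw e UNIV G\<close> by (auto simp: bij_betw_def)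
    moreover have "key (e i) < key (e (Suc i))"
      unfolding key by (rule enumerate_step[OF inf])
    ultimately show ?thesis
      using key_less by (meson leI less_asym)
  qed
  ultimately show ?thesis by blast
qed

lemma finite_magma: "finite {t :: unit magma. leaves t \<le> n}"
proof (induction n)
  case 0
  have "{t :: unit magma. leaves t \<le> 0} = {}"
    using leaves_pos by (metis (no_types, lifting) Collect_empty_eq le_zero_eq not_gr_zero)
  then show ?case by (simp only: finite.emptyI)
next
  case (Suc n)
  have "{t :: unit magma. leaves t \<le> Suc n} \<subseteq>
      insert (Leaf ()) ((\<lambda>(s, t). Node s t) ` ({t. leaves t \<le> n} \<times> {t. leaves t \<le> n}))"
  proof
    fix t :: "unit magma" assume "t \<in> {t. leaves t \<le> Suc n}"
    then show "t \<in> insert (Leaf ()) ((\<lambda>(s, t). Node s t) ` ({t. leaves t \<le> n} \<times> {t. leaves t \<le> n}))"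
    proof (cases t)
      case (Node a b)
      with \<open>t \<in> _\<close> leaves_pos[of a] leaves_pos[of b] show ?thesis by auto
    qed auto
  qed
  then show ?case
    by (rule finite_subset) (simp add: Suc)
qed

text \<open>Trees of the form \<open>x \<cdot> (a \<cdot> b)\<close> are indecomposable, so there are infinitely many
  generators, and they start in degree \<open>3\<close>.\<close>

lemma indecomposable_of_degree: "\<exists>t :: unit magma. indecomposable t \<and> leaves t = n + 3"
proof -
  have "\<exists>a b :: unit magma. leaves (Node a b) = n + 2"
  proof (induction n)
    case 0
    show ?case by (intro exI[of _ "Leaf ()"]) simp
  next
    case (Suc n)
    then obtain a b :: "unit magma" where "leaves (Node a b) = n + 2" by blast
    then show ?case by (intro exI[of _ "Leaf ()"] exI[of _ "Node a b"]) simp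
  qed
  then obtain a b :: "unit magma" where "leaves (Node a b) = n + 2" by blast
  then show ?thesis
    by (intro exI[of _ "Node (Leaf ()) (Node a b)"]) (simp add: indecomposable_def)
qed

lemma leaves_indecomposable: "indecomposable t \<Longrightarrow> 3 \<le> leaves t"
proof (cases t)
  case (Node a b)
  assume "indecomposable t"
  then obtain c d where "b = Node c d"
    using Node by (cases b) (auto simp: indecomposable_def)
  then show ?thesis
    using Node leaves_pos[of a] leaves_pos[of c] leaves_pos[of d] by simp
qed (simp add: indecomposable_def)

lemma free_generators_exist:
  "\<exists>(y :: nat \<Rightarrow> (unit, 'k::field_char_0) free_alg) d. free_generators y d"
proof -
  let ?G = "{t :: unit magma. indecomposable t}"
  have "infinite ?G"
  proof
    assume "finite ?G"
    then obtain n where "\<forall>k\<in>leaves ` ?G. k \<le> n"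
      by (metis finite_imageI finite_nat_set_iff_bounded_le)
    moreover obtain t :: "unit magma" where "indecomposable t" "leaves t = n + 3"
      using indecomposable_of_degree by blast
    ultimately show False by force
  qed
  moreover have "finite {t \<in> ?G. leaves t = n}" for n
    by (rule finite_subset[OF _ finite_magma[of n]]) auto
  ultimately obtain e where e: "bij_betw e UNIV ?G" "\<And>i. leaves (e i) \<le> leaves (e (Suc i))"
    using enumeration_by_size[of ?G leaves] by blast
  then have inj: "inj e" and ran: "range e = ?G"
    by (auto simp: bij_betw_def)
  have "leaves (e 0) = 3"
  proof (rule antisym)
    obtain t :: "unit magma" where "indecomposable t" "leaves t = 3"
      using indecomposable_of_degree[of 0] by auto
    moreover from this have "t \<in> range e"
      using ran by simp
    ultimately obtain i where "leaves (e i) = 3" by blast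
    moreover have "leaves (e 0) \<le> leaves (e i)"
      using lift_Suc_mono_le[of "\<lambda>i. leaves (e i)" 0 i] e(2) by simp
    ultimately show "leaves (e 0) \<le> 3" by simp
    show "3 \<le> leaves (e 0)"
      using leaves_indecomposable ran by blast
  qed
  moreover have "homogeneous (const_part (basis (Some (e i)) :: (unit, 'k) free_alg)) (leaves (e i))" for i
    unfolding homogeneous_def using const_part_graded[of "basis (Some (e i))" "leaves (e i)"] by force
  ultimately have "free_generators (\<lambda>i. const_part (basis (Some (e i)) :: (unit, 'k) free_alg))
      (\<lambda>i. leaves (e i))"
    unfolding free_generators_def
    by (intro conjI allI bij_betw_fsubst_const_part[OF inj ran] e(2))
  then show ?thesis by blast
qed

section \<open>The co-addition in Sweedler notation\<close>

lemma monomial_induct [case_names unit variable product]: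
  assumes "P None" "\<And>x. P (Some (Leaf x))" "\<And>u v. P u \<Longrightarrow> P v \<Longrightarrow> P (umul u v)"
  shows "P u"
proof -
  have "P (Some t)" for t
  proof (induction t)
    case (Node s t)
    with assms(3)[of "Some s" "Some t"] show ?case by simp
  qed (rule assms)
  with assms(1) show ?thesis by (cases u) auto
qed

text \<open>\<open>sweedler u F\<close> is the sum of \<open>F u\<^sub>1 u\<^sub>2\<close> over the terms
  \<open>u\<^sub>1 \<otimes> u\<^sub>2\<close> of the co-addition of the monomial \<open>u\<close>. Passing the summand as a
  function makes iterated coproducts nested sums, so that no tensor product of more than two
  factors has to be formed.\<close>

primrec sweedler_magma ::
    "'x magma \<Rightarrow> ('x magma option \<Rightarrow> 'x magma option \<Rightarrow> 'v::comm_monoid_add) \<Rightarrow> 'v"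
  where
    "sweedler_magma (Leaf x) F = F (Some (Leaf x)) None + F None (Some (Leaf x))"
  | "sweedler_magma (Node s t) F =
      sweedler_magma s (\<lambda>a b. sweedler_magma t (\<lambda>c d. F (umul a c) (umul b d)))"

definition sweedler ::
    "'x magma option \<Rightarrow> ('x magma option \<Rightarrow> 'x magma option \<Rightarrow> 'v::comm_monoid_add) \<Rightarrow> 'v"
  where "sweedler u F = (case u of None \<Rightarrow> F None None | Some t \<Rightarrow> sweedler_magma t F)"

lemma sweedler_simps [simp]:
  "sweedler None F = F None None"
  "sweedler (Some (Leaf x)) F = F (Some (Leaf x)) None + F None (Some (Leaf x))"
  by (simp_all add: sweedler_def)

lemma sweedler_umul [simp]:
  "sweedler (umul u v) F = sweedler u (\<lambda>a b. sweedler v (\<lambda>c d. F (umul a c) (umul b d)))"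
  by (cases u; cases v) (simp_all add: sweedler_def)

text \<open>The restriction to terms of complementary degrees is what makes recursion on the degree
  through \<open>sweedler\<close> well-founded.\<close>

lemma sweedler_cong [fundef_cong]:
  assumes "u = v" "\<And>a b. deg a + deg b = deg v \<Longrightarrow> F a b = G a b"
  shows "sweedler u F = sweedler v G"
proof -
  have "sweedler v F = sweedler v G"
    using assms(2)
  proof (induction v arbitrary: F G rule: monomial_induct)
    case (product u v)
    then show ?case
      unfolding sweedler_umul by (intro product.IH product.prems) (simp add: deg_umul)
  qed auto
  with assms(1) show ?thesis by simp
qed

lemma sweedler_closed:
  assumes "\<And>a b. deg a + deg b = deg u \<Longrightarrow> P (F a b)" "\<And>x y. P x \<Longrightarrow> P y \<Longrightarrow> P (x + y)"
  shows "P (sweedler u F)"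
  using assms(1)
proof (induction u arbitrary: F rule: monomial_induct)
  case (product u v)
  then show ?case
    unfolding sweedler_umul by (intro product.IH product.prems) (simp add: deg_umul)
qed (auto intro: assms(2))

lemma sweedler_add:
  "sweedler u (\<lambda>a b. F a b + G a b) = sweedler u F + sweedler u G"
  by (induction u arbitrary: F G rule: monomial_induct) (simp_all add: ac_simps)

lemma sweedler_zero: "sweedler u (\<lambda>a b. 0) = 0"
  by (induction u rule: monomial_induct) simp_all

lemma sweedler_additive:
  assumes "\<And>x y. h (x + y) = h x + h y"
  shows "h (sweedler u F) = sweedler u (\<lambda>a b. h (F a b))"
  by (induction u arbitrary: F rule: monomial_induct) (simp_all add: assms)

lemma sweedler_swap:
  "sweedler u (\<lambda>a b. sweedler v (F a b)) = sweedler v (\<lambda>c d. sweedler u (\<lambda>a b. F a b c d))"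
  by (induction u arbitrary: F rule: monomial_induct) (simp_all add: sweedler_add)

lemma sweedler_cocommutative: "sweedler u F = sweedler u (\<lambda>a b. F b a)"
proof (induction u arbitrary: F rule: monomial_induct)
  case (product u v)
  show ?case
    unfolding sweedler_umul by (subst product.IH(1), subst product.IH(2)) (rule refl)
qed (simp_all add: add.commute)

lemma sweedler_coassociative:
  "sweedler u (\<lambda>a b. sweedler a (\<lambda>p q. F p q b)) = sweedler u (\<lambda>a b. sweedler b (\<lambda>p q. F a p q))"
proof (induction u arbitrary: F rule: monomial_induct)
  case (product u v)
  have "sweedler (umul u v) (\<lambda>a b. sweedler a (\<lambda>p q. F p q b)) =
      sweedler u (\<lambda>a b. sweedler a (\<lambda>p q. sweedler v (\<lambda>c d. sweedler c (\<lambda>p' q'.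
        F (umul p p') (umul q q') (umul b d)))))"
    unfolding sweedler_umul by (subst sweedler_swap) (rule refl)
  also have "\<dots> = sweedler u (\<lambda>a b. sweedler a (\<lambda>p q. sweedler v (\<lambda>c d. sweedler d (\<lambda>p' q'.
        F (umul p c) (umul q p') (umul b q')))))"
    by (subst product.IH(2)) (rule refl)
  also have "\<dots> = sweedler u (\<lambda>a b. sweedler b (\<lambda>p q. sweedler v (\<lambda>c d. sweedler d (\<lambda>p' q'.
        F (umul a c) (umul p p') (umul q q')))))"
    by (rule product.IH(1))
  also have "\<dots> = sweedler (umul u v) (\<lambda>a b. sweedler b (\<lambda>p q. F a p q))"
    unfolding sweedler_umul by (subst sweedler_swap) (rule refl)
  finally show ?case .
qed (simp_all add: add.assoc)

lemma sweedler_counit: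
  assumes "\<And>a b. a \<noteq> None \<Longrightarrow> F a b = 0"
  shows "sweedler u F = F None u"
  using assms
proof (induction u arbitrary: F rule: monomial_induct)
  case (product u v)
  have "sweedler v (\<lambda>c d. F (umul a c) (umul b d)) = (if a = None then F None (umul b v) else 0)" for a b
  proof (cases a)
    case None
    then show ?thesis
      using product.prems product.IH(2)[of "\<lambda>c d. F c (umul b d)"] by simp
  next
    case (Some t)
    then have "F (umul a c) (umul b d) = 0" for c d
      by (intro product.prems) simp
    with Some show ?thesis
      by (simp add: sweedler_zero)
  qed
  then show ?case
    unfolding sweedler_umul by (simp add: product.IH(1))
qed simp_all

lemma coadd_basis:
  "coadd (basis u :: ('x, 'k::field) free_alg) = sweedler u (\<lambda>a b. basis (a, b))"
proof (induction u rule: monomial_induct)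
  case unit
  show ?case
    using alg_homD(2)[OF alg_hom_coadd] by (simp add: fone_def tone_def)
next
  case (variable x)
  show ?case
    using coadd_gen[of x] by (simp add: gen_def fone_def)
next
  case (product u v)
  have "coadd (basis (umul u v) :: ('x, 'k) free_alg) = tmul (coadd (basis u)) (coadd (basis v))"
    using alg_homD(3)[OF alg_hom_coadd, of "basis u" "basis v"] by simp
  also have "\<dots> = sweedler u (\<lambda>a b. sweedler v (\<lambda>c d. tmul (basis (a, b)) (basis (c, d))))"
    unfolding product
    by (simp add: sweedler_additive[of "\<lambda>p. tmul p q" for q] sweedler_additive[of "tmul p" for p]
        tmul_linear) (subst sweedler_swap, rule refl)
  finally show ?case
    by (simp add: tmul_def)
qed

lemma lin_coadd: "lin coadd"
  by (rule alg_homD(1)[OF alg_hom_coadd])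

lemma lin_coadd_basis:
  assumes "lin f"
  shows "f (coadd (basis u)) = sweedler u (\<lambda>a b. f (basis (a, b)))"
  unfolding coadd_basis by (rule sweedler_additive) (rule lin_add[OF assms])

lemma supp_coadd_basis: "supp (coadd (basis u)) \<subseteq> {(a, b). deg a + deg b = deg u}"
  unfolding coadd_basis
proof (rule sweedler_closed[where P = "\<lambda>t. supp t \<subseteq> {(a, b). deg a + deg b = deg u}"])
  show "supp (s + t) \<subseteq> A" if "supp s \<subseteq> A" "supp t \<subseteq> A"
    for A :: "('a magma option \<times> 'a magma option) set" and s t :: "('a, 'b) free_alg2"
    using that Poly_Mapping.keys_add[of s t] by blast
qed simp

definition counit_left :: "('x, 'k::field) free_alg2 \<Rightarrow> ('x, 'k) free_alg"
  where "counit_left = lin_ext (\<lambda>(a, b). if a = None then basis b else 0)"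

lemma counit_left_coadd: "counit_left (coadd p) = p"
proof (rule linear_eq_on_basis[where f = "\<lambda>p. counit_left (coadd p)" and g = "\<lambda>p. p"])
  have lin: "lin counit_left"
    unfolding counit_left_def by (rule linear_lin_ext)
  then show "lin (\<lambda>p. counit_left (coadd p))"
    by (rule linear_comp[OF _ lin_coadd])
  show "counit_left (coadd (basis u)) = basis u" for u
    unfolding lin_coadd_basis[OF lin]
    by (subst sweedler_counit) (auto simp: counit_left_def)
qed (rule linear_id_scale)

lemma counit_left_tensor_fone:
  "counit_left (tensor p fone) = scale (coeff p None) (fone :: ('x, 'k::field) free_alg)"
proof (rule poly_mapping_eqI)
  fix u
  let ?t = "tensor p (fone :: ('x, 'k) free_alg)"
  have "counit_left ?t = lin_ext (\<lambda>b. if b = (None, None) then fone else 0) ?t"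
    unfolding counit_left_def
    by (rule lin_ext_cong) (auto simp: supp_tensor fone_def split: if_splits)
  then have "coeff (counit_left ?t) u =
      (\<Sum>b\<in>supp ?t. coeff ?t b * coeff (if b = (None, None) then fone else 0) u)"
    by (simp only: coeff_lin_ext)
  also have "\<dots> = (\<Sum>b\<in>supp ?t. if b = (None, None) then coeff ?t b * coeff fone u else 0)"
    by (intro sum.cong) auto
  also have "\<dots> = coeff (scale (coeff p None) fone) u"
    by (auto simp: in_keys_iff coeff_tensor coeff_fone)
  finally show "coeff (counit_left ?t) u = coeff (scale (coeff p None) fone) u" .
qed

definition flip :: "('a \<times> 'b \<Rightarrow>\<^sub>0 'k::field) \<Rightarrow> ('b \<times> 'a \<Rightarrow>\<^sub>0 'k)"
  where "flip = lin_ext (\<lambda>(a, b). basis (b, a))"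

lemma lin_flip: "lin flip"
  unfolding flip_def by (rule linear_lin_ext)

lemma flip_tensor: "flip (tensor p q) = tensor q p"
  by (rule bilinear_eq_on_basis[where F = "\<lambda>p q. flip (tensor p q)" and G = "\<lambda>p q. tensor q p"])
    ((rule lin_intros linear_comp[OF lin_flip])+, simp add: flip_def)

lemma flip_tensor_map: "flip (tensor_map f g t) = tensor_map g f (flip t)"
proof (rule linear_eq_on_basis[where f = "\<lambda>t. flip (tensor_map f g t)"])
  show "flip (tensor_map f g (basis b)) = tensor_map g f (flip (basis b))" for b
    by (cases b) (simp add: tensor_map_basis flip_tensor, simp add: flip_def tensor_map_basis)
qed (rule lin_intros linear_comp[OF lin_flip] lin_flip)+

lemma flip_coadd: "flip (coadd p) = coadd p"
proof (rule linear_eq_on_basis[where f = "\<lambda>p. flip (coadd p)"])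
  show "flip (coadd (basis u)) = coadd (basis u)" for u
  proof -
    have "flip (coadd (basis u)) = sweedler u (\<lambda>a b. basis (b, a))"
      unfolding lin_coadd_basis[OF lin_flip] by (simp add: flip_def)
    also have "\<dots> = coadd (basis u)"
      unfolding coadd_basis by (rule sweedler_cocommutative[symmetric])
    finally show ?thesis .
  qed
qed (rule linear_comp[OF lin_flip] lin_coadd)+

text \<open>As functions of \<open>p\<close>, both sides are derivations along the co-addition with the value
  \<open>1 \<otimes> 1\<close> at \<open>x\<close>.\<close>

lemma ddx_left_coadd: "tensor_map ddx (\<lambda>p. p) (coadd p) = coadd (ddx p)"
proof -
  let ?D = "tensor_map ddx (\<lambda>p. p) :: (unit, 'a) free_alg2 \<Rightarrow> (unit, 'a) free_alg2"
  have tensor: "?D (tensor p q) = tensor (ddx p) q" for p q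
    by (rule tensor_map_tensor[OF linear_ddx linear_id_scale])
  have leibniz: "?D (tmul s t) = tmul (?D s) t + tmul s (?D t)" for s t
  proof (rule bilinear_eq_on_basis[where F = "\<lambda>s t. ?D (tmul s t)"
        and G = "\<lambda>s t. tmul (?D s) t + tmul s (?D t)"])
    fix s t :: "unit magma option \<times> unit magma option"
    obtain a b c d where st: "s = (a, b)" "t = (c, d)" by (cases s, cases t) auto
    have st: "(basis s :: (unit, 'a) free_alg2) = tensor (basis a) (basis b)"
      "(basis t :: (unit, 'a) free_alg2) = tensor (basis c) (basis d)"
      by (simp_all add: st)
    show "?D (tmul (basis s) (basis t)) = tmul (?D (basis s)) (basis t) + tmul (basis s) (?D (basis t))"
      unfolding st tmul_tensor tensor by (simp only: ddx_fmul tensor_linear)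
  qed (rule lin_intros)+
  have basis: "?D (coadd (basis u)) = coadd (ddx (basis u))" for u
  proof (induction u rule: monomial_induct)
    case unit
    have "?D (coadd fone) = coadd (ddx fone)"
      by (simp add: alg_homD(2)[OF alg_hom_coadd] tone_def tensor ddx_fone tensor_linear lin_zero[OF lin_coadd])
    then show ?case by (simp add: fone_def)
  next
    case (variable x)
    have "?D (coadd (gen x)) = coadd (ddx (gen x))"
      by (simp add: coadd_gen lin_add[OF lin_tensor_map] tensor ddx_gen ddx_fone tensor_linear
          alg_homD(2)[OF alg_hom_coadd] tone_def)
    then show ?case by (simp add: gen_def)
  next
    case (product u v)
    have "?D (coadd (fmul (basis u) (basis v))) = coadd (ddx (fmul (basis u) (basis v)))"
      unfolding ddx_fmul alg_homD(3)[OF alg_hom_coadd] leibniz lin_add[OF lin_coadd] product ..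
    then show ?case by simp
  qed
  show ?thesis
    by (rule linear_eq_on_basis[where f = "\<lambda>p. ?D (coadd p)" and g = "\<lambda>p. coadd (ddx p)"])
      ((rule lin_intros lin_coadd linear_comp[OF lin_coadd linear_ddx])+, rule basis)
qed

definition primitive :: "('x, 'k::field) free_alg \<Rightarrow> bool"
  where "primitive p \<longleftrightarrow> coadd p = tensor p fone + tensor fone p"

text \<open>Differentiating the left factor shows that \<open>q = p'\<close> has coproduct \<open>q \<otimes> 1\<close>; the
  counit then makes \<open>q\<close> a scalar, which is the coefficient of \<open>x\<close> in \<open>p\<close>.\<close>

lemma primitive_imp_constant:
  fixes p :: "(unit, 'k::field) free_alg"
  assumes "primitive p" "coeff p (Some (Leaf ())) = 0"
  shows "p \<in> constants"
proof -
  have "coadd (ddx p) = tensor_map ddx (\<lambda>p. p) (tensor p fone + tensor fone p)"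
    using assms(1) by (simp add: primitive_def flip: ddx_left_coadd)
  also have "\<dots> = tensor (ddx p) fone"
    by (simp add: lin_add[OF lin_tensor_map] tensor_map_tensor[OF linear_ddx linear_id_scale] ddx_fone tensor_linear)
  finally have "ddx p = scale (coeff (ddx p) None) fone"
    by (metis counit_left_coadd counit_left_tensor_fone)
  moreover have "coeff (ddx p) None = 0"
  proof (rule ccontr)
    assume "coeff (ddx p) None \<noteq> 0"
    moreover have "ddx p = lin_ext (\<lambda>u. ddx (basis u)) p"
      by (rule lin_as_lin_ext[OF linear_ddx])
    ultimately have "None \<in> supp (lin_ext (\<lambda>u. ddx (basis u)) p)"
      by (simp add: in_keys_iff)
    then obtain u where u: "u \<in> supp p" "None \<in> supp (ddx (basis u) :: (unit, 'k) free_alg)"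
      using supp_lin_ext by fastforce
    then have "deg u = 1"
      using supp_ddx_basis by fastforce
    then have "u = Some (Leaf ())"
    proof (cases u)
      case (Some t)
      with \<open>deg u = 1\<close> show ?thesis
      proof (cases t)
        case (Node a b)
        with \<open>deg u = 1\<close> Some leaves_pos[of a] leaves_pos[of b] show ?thesis by simp
      qed simp
    qed simp
    with u(1) assms(2) show False
      by (simp add: in_keys_iff)
  qed
  ultimately show ?thesis
    by (simp add: constants_def)
qed

section \<open>The Dynkin operator\<close>

text \<open>The Dynkin operator is determined by \<open>deg h \<cdot> h = \<Sum> h\<^sub>1 \<cdot> \<delta> h\<^sub>2\<close>, where the summand
  with \<open>h\<^sub>1 = 1\<close> is \<open>\<delta> h\<close>. For an associative Hopf algebra it is the convolution
  \<open>S * deg\<close> of the antipode and the grading operator; this recursion does without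
  antipode and associativity.\<close>

function dynkin_monomial :: "'x magma option \<Rightarrow> ('x, 'k::field) free_alg"
  where
    "dynkin_monomial u = scale (of_nat (deg u)) (basis u) -
      sweedler u (\<lambda>a b. if a = None then 0 else fmul (basis a) (dynkin_monomial b))"
  by auto
termination
proof (relation "measure deg")
  fix u a b :: "'x magma option"
  assume "deg a + deg b = deg u" "a \<noteq> None"
  then show "(b, u) \<in> measure deg"
    using deg_pos[of a] by simp
qed simp

declare dynkin_monomial.simps [simp del]

lemma sweedler_dynkin:
  "sweedler u (\<lambda>a b. fmul (basis a) (dynkin_monomial b)) = scale (of_nat (deg u)) (basis u)"
proof -
  have "sweedler u (\<lambda>a b. fmul (basis a) (dynkin_monomial b)) =
      sweedler u (\<lambda>a b. (if a = None then fmul (basis a) (dynkin_monomial b) else 0) +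
        (if a = None then 0 else fmul (basis a) (dynkin_monomial b)))"
    by (rule sweedler_cong) auto
  also have "\<dots> = dynkin_monomial u +
      sweedler u (\<lambda>a b. if a = None then 0 else fmul (basis a) (dynkin_monomial b))"
    unfolding sweedler_add by (subst sweedler_counit) (auto simp: fone_unit simp flip: fone_def)
  finally show ?thesis
    by (subst (asm) (2) dynkin_monomial.simps) simp
qed

text \<open>For the defect \<open>P h = \<Delta> (\<delta> h) - \<delta> h \<otimes> 1 - 1 \<otimes> \<delta> h\<close>, coassociativity and
  cocommutativity turn \<open>\<Sum> \<Delta> h\<^sub>1 \<cdot> P h\<^sub>2\<close> into
  \<open>deg h \<cdot> \<Delta> h - \<Sum> (deg h\<^sub>1 + deg h\<^sub>2) \<cdot> h\<^sub>1 \<otimes> h\<^sub>2 = 0\<close>. The summand with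
  \<open>h\<^sub>1 = 1\<close> is \<open>P h\<close> and the others vanish by induction on the degree.\<close>

lemma primitive_dynkin_monomial: "primitive (dynkin_monomial u :: ('x, 'k::field) free_alg)"
proof -
  define P :: "'x magma option \<Rightarrow> ('x, 'k) free_alg2" where
    "P b = coadd (dynkin_monomial b) - (tensor (dynkin_monomial b) fone + tensor fone (dynkin_monomial b))" for b
  have one: "primitive (dynkin_monomial u :: ('x, 'k) free_alg) \<longleftrightarrow> P u = 0" for u
    by (simp add: P_def primitive_def)
  let ?\<delta> = "dynkin_monomial :: 'x magma option \<Rightarrow> ('x, 'k) free_alg"
  have tmul_coadd: "tmul (coadd (basis a)) t = sweedler a (\<lambda>p q. tmul (tensor (basis p) (basis q)) t)"
    for a and t :: "('x, 'k) free_alg2"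
    using lin_coadd_basis[OF lin_tmul_left] by simp
  have "sweedler u (\<lambda>a b. tmul (coadd (basis a)) (P b)) = 0" for u
  proof -
    have 1: "sweedler u (\<lambda>a b. tmul (coadd (basis a)) (coadd (?\<delta> b))) =
        scale (of_nat (deg u)) (sweedler u (\<lambda>a b. basis (a, b)))"
    proof -
      have "sweedler u (\<lambda>a b. tmul (coadd (basis a)) (coadd (?\<delta> b))) =
          coadd (sweedler u (\<lambda>a b. fmul (basis a) (?\<delta> b)) :: ('x, 'k) free_alg)"
        by (simp add: sweedler_additive[of coadd] lin_add[OF lin_coadd] alg_homD(3)[OF alg_hom_coadd])
      also have "\<dots> = scale (of_nat (deg u)) (coadd (basis u))"
        by (simp add: sweedler_dynkin lin_scale[OF lin_coadd])
      finally show ?thesis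
        unfolding coadd_basis[of u] .
    qed
    have 2: "sweedler u (\<lambda>a b. tmul (coadd (basis a)) (tensor (?\<delta> b) fone)) =
        sweedler u (\<lambda>a b. scale (of_nat (deg a)) (basis (a, b)))"
    proof -
      have "sweedler u (\<lambda>a b. tmul (coadd (basis a)) (tensor (?\<delta> b) fone)) =
          sweedler u (\<lambda>a b. sweedler a (\<lambda>p q. tensor (fmul (basis p) (?\<delta> b)) (basis q)))"
        unfolding tmul_coadd tmul_tensor fone_unit ..
      also have "\<dots> = sweedler u (\<lambda>p c. sweedler c (\<lambda>q b. tensor (fmul (basis p) (?\<delta> b)) (basis q)))"
        by (rule sweedler_coassociative)
      also have "\<dots> = sweedler u (\<lambda>p c. sweedler c (\<lambda>b q. tensor (fmul (basis p) (?\<delta> b)) (basis q)))"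
        by (subst sweedler_cocommutative) (rule refl)
      also have "\<dots> = sweedler u (\<lambda>a q. sweedler a (\<lambda>p b. tensor (fmul (basis p) (?\<delta> b)) (basis q)))"
        by (rule sweedler_coassociative[symmetric])
      also have "\<dots> = sweedler u (\<lambda>a q. tensor (sweedler a (\<lambda>p b. fmul (basis p) (?\<delta> b))) (basis q))"
        by (subst sweedler_additive[of "\<lambda>x. tensor x q" for q]) (simp_all add: tensor_linear)
      finally show ?thesis
        by (simp add: sweedler_dynkin tensor_linear)
    qed
    have 3: "sweedler u (\<lambda>a b. tmul (coadd (basis a)) (tensor fone (?\<delta> b))) =
        sweedler u (\<lambda>a b. scale (of_nat (deg b)) (basis (a, b)))"
    proof -
      have "sweedler u (\<lambda>a b. tmul (coadd (basis a)) (tensor fone (?\<delta> b))) =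
          sweedler u (\<lambda>a b. sweedler a (\<lambda>p q. tensor (basis p) (fmul (basis q) (?\<delta> b))))"
        unfolding tmul_coadd tmul_tensor fone_unit ..
      also have "\<dots> = sweedler u (\<lambda>p c. sweedler c (\<lambda>q b. tensor (basis p) (fmul (basis q) (?\<delta> b))))"
        by (rule sweedler_coassociative)
      also have "\<dots> = sweedler u (\<lambda>p c. tensor (basis p) (sweedler c (\<lambda>q b. fmul (basis q) (?\<delta> b))))"
        by (subst sweedler_additive[of "tensor p" for p]) (simp_all add: tensor_linear)
      finally show ?thesis
        by (simp add: sweedler_dynkin tensor_linear)
    qed
    have "sweedler u (\<lambda>a b. tmul (coadd (basis a)) (P b)) +
        (sweedler u (\<lambda>a b. tmul (coadd (basis a)) (tensor (?\<delta> b) fone)) +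
         sweedler u (\<lambda>a b. tmul (coadd (basis a)) (tensor fone (?\<delta> b)))) =
        sweedler u (\<lambda>a b. tmul (coadd (basis a)) (coadd (?\<delta> b)))"
      unfolding sweedler_add[symmetric] tmul_linear(6)[symmetric] P_def by simp
    moreover have "sweedler u (\<lambda>a b. scale (of_nat (deg a)) (basis (a, b))) +
        sweedler u (\<lambda>a b. scale (of_nat (deg b)) (basis (a, b))) =
        scale (of_nat (deg u)) (sweedler u (\<lambda>a b. basis (a, b)) :: ('x, 'k) free_alg2)"
    proof -
      have "sweedler u (\<lambda>a b. scale (of_nat (deg a)) (basis (a, b))) +
          sweedler u (\<lambda>a b. scale (of_nat (deg b)) (basis (a, b))) =
          sweedler u (\<lambda>a b. scale (of_nat (deg a + deg b)) (basis (a, b)) :: ('x, 'k) free_alg2)"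
        by (simp add: scale_distribs flip: sweedler_add)
      also have "\<dots> = sweedler u (\<lambda>a b. scale (of_nat (deg u)) (basis (a, b)))"
        by (rule sweedler_cong) simp_all
      also have "\<dots> = scale (of_nat (deg u)) (sweedler u (\<lambda>a b. basis (a, b)))"
        by (rule sweedler_additive[symmetric]) (rule scale_distribs)
      finally show ?thesis .
    qed
    ultimately show ?thesis
      unfolding 1 2 3 by simp
  qed
  note defect = this
  have "P u = 0" for u
  proof (induction u rule: measure_induct_rule[of deg])
    case (less u)
    have "0 = sweedler u (\<lambda>a b. tmul (coadd (basis a)) (P b))"
      by (rule defect[symmetric])
    also have "\<dots> = sweedler u (\<lambda>a b. if a = None then P b else 0)"
    proof (rule sweedler_cong)
      fix a b :: "'x magma option" assume "deg a + deg b = deg u"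
      then show "tmul (coadd (basis a)) (P b) = (if a = None then P b else 0)"
        using less[of b] deg_pos[of a]
        by (cases a)
          (simp_all add: tmul_linear tone_unit alg_homD(2)[OF alg_hom_coadd] flip: fone_def)
    qed simp
    also have "\<dots> = P u"
      by (subst sweedler_counit) auto
    finally show ?case by simp
  qed
  then show ?thesis
    by (simp add: one)
qed

lemma supp_dynkin_monomial:
  "supp (dynkin_monomial u :: ('x, 'k::field) free_alg) \<subseteq> {v. deg v = deg u}"
proof (induction u rule: measure_induct_rule[of deg])
  case (less u)
  have "supp (sweedler u (\<lambda>a b. if a = None then 0 else fmul (basis a) (dynkin_monomial b :: ('x, 'k) free_alg)))
      \<subseteq> {v. deg v = deg u}"
  proof (rule sweedler_closed[where P = "\<lambda>t. supp t \<subseteq> {v. deg v = deg u}"])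
    fix a b :: "'x magma option" assume deg: "deg a + deg b = deg u"
    show "supp (if a = None then 0 else fmul (basis a) (dynkin_monomial b :: ('x, 'k) free_alg))
        \<subseteq> {v. deg v = deg u}"
    proof (cases "a = None")
      case False
      then have "deg b < deg u"
        using deg deg_pos[of a] by simp
      from supp_fmul_graded[OF deg_umul _ less[OF this], of "basis a" "deg a"] False deg show ?thesis
        by simp
    qed simp
  next
    show "supp (s + t) \<subseteq> A" if "supp s \<subseteq> A" "supp t \<subseteq> A"
      for A :: "'x magma option set" and s t :: "('x, 'k) free_alg"
      using that Poly_Mapping.keys_add[of s t] by blast
  qed
  moreover have "supp (scale (of_nat (deg u)) (basis u) :: ('x, 'k) free_alg) \<subseteq> {v. deg v = deg u}"
    by (rule order.trans[OF supp_scale]) simp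
  ultimately show ?case
    by (subst dynkin_monomial.simps) (meson Un_least subset_trans supp_diff)
qed

definition dynkin :: "('x, 'k::field) free_alg \<Rightarrow> ('x, 'k) free_alg"
  where "dynkin = lin_ext dynkin_monomial"

lemma lin_dynkin: "lin dynkin"
  unfolding dynkin_def by (rule linear_lin_ext)

lemma supp_dynkin:
  assumes "supp p \<subseteq> {v. deg v = n}"
  shows "supp (dynkin p) \<subseteq> {v. deg v = n}"
proof -
  have "supp (dynkin p) \<subseteq> (\<Union>u\<in>supp p. supp (dynkin_monomial u :: ('a, 'b) free_alg))"
    unfolding dynkin_def by (rule supp_lin_ext)
  also have "\<dots> \<subseteq> {v. deg v = n}"
    using assms supp_dynkin_monomial by blast
  finally show ?thesis .
qed

lemma primitive_dynkin: "primitive (dynkin p)"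
  unfolding primitive_def
proof (rule linear_eq_on_basis[where f = "\<lambda>p. coadd (dynkin p)" and
      g = "\<lambda>p. tensor (dynkin p) fone + tensor fone (dynkin p)"])
  show "coadd (dynkin (basis u)) = tensor (dynkin (basis u)) fone + tensor fone (dynkin (basis u))" for u
    using primitive_dynkin_monomial[of u] by (simp add: dynkin_def primitive_def)
qed (rule lin_intros lin_dynkin linear_comp[OF lin_coadd lin_dynkin])+

text \<open>The part of \<open>h\<^sub>1 \<cdot> \<delta> h\<^sub>2\<close> in which \<open>h\<^sub>1\<close> is in the augmentation ideal.\<close>

definition reduced_dynkin :: "('x, 'k::field) free_alg2 \<Rightarrow> ('x, 'k) free_alg"
  where "reduced_dynkin = lin_ext (\<lambda>(a, b). if a = None then 0 else fmul (basis a) (dynkin_monomial b))"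

lemma lin_reduced_dynkin: "lin reduced_dynkin"
  unfolding reduced_dynkin_def by (rule linear_lin_ext)

lemma dynkin_recursion: "dynkin p = euler deg p - reduced_dynkin (coadd p)"
proof (rule linear_eq_on_basis[where g = "\<lambda>p. euler deg p - reduced_dynkin (coadd p)"])
  show "dynkin (basis u) = euler deg (basis u) - reduced_dynkin (coadd (basis u))" for u
    unfolding lin_coadd_basis[OF lin_reduced_dynkin]
    by (simp add: dynkin_def reduced_dynkin_def dynkin_monomial.simps[of u])
qed (rule lin_dynkin lin_intros lin_euler linear_comp[OF lin_reduced_dynkin lin_coadd])+

lemma reduced_dynkin_tensor:
  assumes "coeff p None = 0"
  shows "reduced_dynkin (tensor p q) = fmul p (dynkin q)"
proof -
  have "reduced_dynkin (tensor p q) = lin_ext (\<lambda>(a, b). fmul (basis a) (dynkin_monomial b)) (tensor p q)"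
    unfolding reduced_dynkin_def
    by (rule lin_ext_cong) (use assms in \<open>auto simp: supp_tensor in_keys_iff\<close>)
  also have "\<dots> = fmul p (dynkin q)"
    by (rule bilinear_eq_on_basis[where F = "\<lambda>p q. lin_ext (\<lambda>(a, b). fmul (basis a) (dynkin_monomial b)) (tensor p q)"
          and G = "\<lambda>p q. fmul p (dynkin q)"])
      ((rule lin_intros lin_dynkin linear_comp[OF linear_lin_ext])+, simp add: dynkin_def)
  finally show ?thesis .
qed

lemma reduced_dynkin_tensor_fone: "reduced_dynkin (tensor fone q) = 0"
  by (rule linear_eq_on_basis[where f = "\<lambda>q. reduced_dynkin (tensor fone q)" and g = "\<lambda>q. scale 0 q", simplified])
    (use linear_comp[OF lin_reduced_dynkin lin_tensor_right] lin_scaled[of 0] in \<open>auto simp: fone_def reduced_dynkin_def\<close>)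

section \<open>Strict automorphisms of free algebras\<close>

lemma supp_fmul_filtered:
  assumes "supp p \<subseteq> {u. m \<le> deg u}" "supp q \<subseteq> {u. n \<le> deg u}"
  shows "supp (fmul p q) \<subseteq> {u. m + n \<le> deg u}"
proof
  fix w assume "w \<in> supp (fmul p q)"
  then have "w \<in> (\<lambda>(u, v). umul u v) ` (supp p \<times> supp q)"
    using supp_bilin_ext[of umul p q] unfolding fmul_def by (rule subsetD[rotated])
  then obtain u v where uv: "u \<in> supp p" "v \<in> supp q" and w: "w = umul u v"
    by auto
  have "m \<le> deg u" "n \<le> deg v"
    using uv assms by auto
  then show "w \<in> {u. m + n \<le> deg u}"
    by (simp add: w deg_umul)
qed

text \<open>Such a substitution induces the identity on the graded pieces of the filtration by degree;
  hence it is injective, and preimages lie as deep in the filtration as their images, which makes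
  the inverse strict. It is onto since by homogeneity the higher terms in the image of a variable
  are products of monomials of smaller weight.\<close>

lemma strict_automorphism:
  fixes z :: "'y \<Rightarrow> ('y, 'k::field) free_alg" and d :: "'y \<Rightarrow> nat"
  assumes d: "\<And>i. 0 < d i"
    and z: "\<And>i. supp (z i - gen i) \<subseteq> {u. 2 \<le> deg u \<and> weight d u = d i}"
  shows "bij (fsubst z)" "strict (inv (fsubst z))"
proof -
  let ?\<psi> = "fsubst z"
  note \<psi> = alg_homD[OF alg_hom_fsubst, of z]
  have basis: "supp (?\<psi> (basis u) - basis u) \<subseteq> {v. deg u < deg v}" for u
  proof (induction u rule: monomial_induct)
    case unit
    show ?case using \<psi>(2) by (simp add: fone_def)
  next
    case (variable i)
    have "?\<psi> (basis (Some (Leaf i))) - basis (Some (Leaf i)) = z i - gen i"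
      using fsubst_gen[of z i] by (simp add: gen_def)
    then show ?case using z[of i] by auto
  next
    case (product u v)
    let ?p = "?\<psi> (basis u)" and ?q = "?\<psi> (basis v)"
    have q: "supp ?q \<subseteq> {w. deg v \<le> deg w}"
    proof
      fix w assume "w \<in> supp ?q"
      then have "w \<in> supp (?q - basis v) \<or> w = v"
        by (auto simp: in_keys_iff lookup_minus coeff_basis)
      with product(2) show "w \<in> {w. deg v \<le> deg w}" by auto
    qed
    have "?\<psi> (basis (umul u v)) - basis (umul u v) = fmul ?p ?q - fmul (basis u) (basis v)"
      using \<psi>(3)[of "basis u" "basis v"] by simp
    also have "\<dots> = fmul (?p - basis u) ?q + fmul (basis u) (?q - basis v)"
      unfolding fmul_linear by (simp del: fmul_basis)
    finally have eq: "?\<psi> (basis (umul u v)) - basis (umul u v) =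
        fmul (?p - basis u) ?q + fmul (basis u) (?q - basis v)" .
    have "supp (fmul (?p - basis u) ?q) \<subseteq> {w. Suc (deg u) + deg v \<le> deg w}"
      by (rule supp_fmul_filtered[OF _ q]) (use product(1) in auto)
    moreover have "supp (fmul (basis u) (?q - basis v)) \<subseteq> {w. deg u + Suc (deg v) \<le> deg w}"
      by (rule supp_fmul_filtered) (use product(2) in auto)
    ultimately show ?case
      unfolding eq deg_umul
      using Poly_Mapping.keys_add[of "fmul (?p - basis u) ?q" "fmul (basis u) (?q - basis v)"]
      by fastforce
  qed
  have filtered: "supp (?\<psi> f - f) \<subseteq> {v. m < deg v}" if f: "supp f \<subseteq> {v. m \<le> deg v}" for f m
  proof -
    have "?\<psi> f - f = lin_ext (\<lambda>u. ?\<psi> (basis u) - basis u) f"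
      by (rule lin_as_lin_ext[OF lin_minus[OF \<psi>(1) linear_id_scale]])
    then have "supp (?\<psi> f - f) \<subseteq> (\<Union>u\<in>supp f. supp (?\<psi> (basis u) - basis u))"
      by (simp only: supp_lin_ext)
    also have "\<dots> \<subseteq> {v. m < deg v}"
      using basis f by force
    finally show ?thesis .
  qed
  have reflects: "supp f \<subseteq> {v. m \<le> deg v}" if "supp (?\<psi> f) \<subseteq> {v. m \<le> deg v}" for f m
    using that
  proof (induction m)
    case (Suc m)
    then have "supp (?\<psi> f) \<subseteq> {v. m \<le> deg v}" by force
    then have f: "supp f \<subseteq> {v. m \<le> deg v}" by (rule Suc.IH)
    show ?case
    proof
      fix v assume "v \<in> supp f"
      then have "v \<in> supp (?\<psi> f - f) \<or> v \<in> supp (?\<psi> f)"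
        by (auto simp: in_keys_iff lookup_minus)
      then show "v \<in> {v. Suc m \<le> deg v}"
        using filtered[OF f] Suc.prems by auto
    qed
  qed simp
  have inj: "inj ?\<psi>"
  proof (rule injI)
    fix f g assume "?\<psi> f = ?\<psi> g"
    then have eq: "?\<psi> (f - g) = 0"
      by (simp add: lin_diff[OF \<psi>(1)])
    have *: "supp (f - g) \<subseteq> {v. m \<le> deg v}" for m
      by (rule reflects) (simp add: eq)
    have "v \<notin> supp (f - g)" for v
      using subsetD[OF *[of "Suc (deg v)"], of v] by auto
    then have "supp (f - g) = {}" by blast
    then show "f = g" by simp
  qed
  have range_lin_ext: "lin_ext h p \<in> range ?\<psi>" if "\<And>u. u \<in> supp p \<Longrightarrow> h u \<in> range ?\<psi>"
    for h :: "'y magma option \<Rightarrow> ('y, 'k) free_alg" and p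
  proof -
    have "lin_ext h p = lin_ext (\<lambda>u. ?\<psi> (inv ?\<psi> (h u))) p"
      by (rule lin_ext_cong) (simp add: that f_inv_into_f)
    also have "\<dots> = ?\<psi> (lin_ext (\<lambda>u. inv ?\<psi> (h u)) p)"
      by (rule lin_lin_ext[OF \<psi>(1), symmetric])
    finally show ?thesis by simp
  qed
  have range: "basis u \<in> range ?\<psi>" for u
  proof (induction u rule: measure_induct_rule[of "weight d"])
    case (less u)
    have node: "basis v \<in> range ?\<psi>" if v: "2 \<le> deg v" "weight d v = weight d u" for v
    proof -
      from v(1) obtain s t where st: "v = Some (Node s t)"
      proof (cases v)
        case (Some t)
        then show ?thesis
          using that v(1) by (cases t) auto
      qed simp
      have "0 < weight d (Some s)" "0 < weight d (Some t)"
        by (simp_all add: weight_pos d)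
      then have "weight d (Some s) < weight d u" "weight d (Some t) < weight d u"
        using v(2) by (simp_all add: st)
      from less[OF this(1)] less[OF this(2)] obtain p q
        where pq: "basis (Some s) = ?\<psi> p" "basis (Some t) = ?\<psi> q" by (elim rangeE)
      have "?\<psi> (fmul p q) = basis v"
        by (simp add: \<psi>(3) st flip: pq)
      then show ?thesis by (metis rangeI)
    qed
    show ?case
    proof (cases u)
      case None
      then show ?thesis
        using \<psi>(2) by (metis fone_def rangeI)
    next
      case (Some t)
      show ?thesis
      proof (cases t)
        case (Leaf i)
        have "z i - gen i \<in> range ?\<psi>"
        proof -
          have "lin_ext basis (z i - gen i) \<in> range ?\<psi>"
            by (rule range_lin_ext) (use z[of i] node Some Leaf in auto)
          then show ?thesis by (simp only: lin_ext_basis_id)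
        qed
        then obtain r where r: "z i - gen i = ?\<psi> r" by (rule rangeE)
        have "?\<psi> (gen i - r) = basis u"
          by (simp add: lin_diff[OF \<psi>(1)] fsubst_gen flip: r) (simp add: gen_def Some Leaf)
        then show ?thesis by (metis rangeI)
      next
        case (Node a b)
        then show ?thesis
          using node[of u] Some leaves_pos[of a] leaves_pos[of b] by simp
      qed
    qed
  qed
  have "surj ?\<psi>"
  proof -
    have "lin_ext basis p \<in> range ?\<psi>" for p
      by (rule range_lin_ext) (rule range)
    then show ?thesis by (auto simp: lin_ext_basis_id)
  qed
  with inj show "bij ?\<psi>"
    by (rule bijI)
  show "strict (inv ?\<psi>)"
    unfolding strict_def
  proof (intro allI ballI)
    fix i u assume u: "u \<in> supp (inv ?\<psi> (gen i) - gen i)"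
    have eq: "?\<psi> (inv ?\<psi> (gen i) - gen i) = gen i - z i"
      by (simp add: lin_diff[OF \<psi>(1)] fsubst_gen surj_f_inv_f[OF \<open>surj ?\<psi>\<close>])
    have "supp (gen i - z i) = supp (z i - gen i)"
      by (auto simp: in_keys_iff lookup_minus)
    with z[of i] have "supp (inv ?\<psi> (gen i) - gen i) \<subseteq> {v. 2 \<le> deg v}"
      by (intro reflects[of "inv ?\<psi> (gen i) - gen i" 2, unfolded eq]) auto
    with u show "2 \<le> deg u" by blast
  qed
qed

lemma alg_hom_inv:
  assumes f: "alg_hom fmul fone fmul fone f" "bij f"
  shows "alg_hom fmul fone fmul fone (inv f)"
  unfolding alg_hom_def
proof (intro conjI allI)
  have *: "f (inv f p) = p" for p
    using f(2) by (simp add: bij_is_surj surj_f_inv_f)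
  show "lin (inv f)"
    by (rule lin_inv[OF alg_homD(1)[OF f(1)] f(2)])
  show "inv f fone = fone"
    by (rule inv_f_eq[OF bij_is_inj[OF f(2)] alg_homD(2)[OF f(1)]])
  show "inv f (fmul p q) = fmul (inv f p) (inv f q)" for p q
    by (rule inv_f_eq[OF bij_is_inj[OF f(2)]]) (simp add: alg_homD(3)[OF f(1)] *)
qed

section \<open>The co-addition on the constants\<close>

locale constants_basis =
  fixes y :: "nat \<Rightarrow> (unit, 'k::field_char_0) free_alg" and d :: "nat \<Rightarrow> nat"
  assumes free: "free_generators y d"
begin

lemma bij_fsubst: "bij_betw (fsubst y) UNIV constants"
  using free by (simp add: free_generators_def)

lemma inj_fsubst: "inj (fsubst y)"
  using bij_fsubst by (rule bij_betw_imp_inj_on)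

lemma fsubst_in_constants: "fsubst y f \<in> constants"
  using bij_fsubst by (auto simp: bij_betw_def)

lemma degree_ge_3: "3 \<le> d i"
  using lift_Suc_mono_le[of d 0 i] free by (simp add: free_generators_def)

lemma degree_pos: "0 < d i"
  using degree_ge_3[of i] by simp

lemma supp_fsubst: "supp (fsubst y (basis u)) \<subseteq> {v. deg v = weight d u}"
  by (rule fsubst_graded[OF deg_umul]) (use free in \<open>auto simp: free_generators_def homogeneous_def\<close>)

lemma coeff_fsubst_None: "u \<noteq> None \<Longrightarrow> coeff (fsubst y (basis u)) None = 0"
proof (rule ccontr)
  assume "u \<noteq> None" "coeff (fsubst y (basis u)) None \<noteq> 0"
  then have "weight d u = 0"
    using supp_fsubst[of u] by (auto simp: in_keys_iff)
  then show False
    using weight_pos[of d u] degree_pos \<open>u \<noteq> None\<close> by simp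
qed

text \<open>A linear left inverse of the embedding \<open>fsubst y\<close>, defined on all of \<open>K{x}\<close> so that it
  can be applied to the factors of a tensor.\<close>

definition coords :: "(unit, 'k) free_alg \<Rightarrow> (nat, 'k) free_alg"
  where "coords p = inv (fsubst y) (const_part p)"

lemma fsubst_coords: "fsubst y (coords p) = const_part p"
  unfolding coords_def
  using bij_fsubst const_part_constant by (metis bij_betw_imp_surj_on f_inv_into_f)

lemma coords_fsubst: "coords (fsubst y f) = f"
  by (simp add: coords_def const_part_of_constant fsubst_in_constants inv_f_f inj_fsubst)

lemma lin_coords: "lin coords"
  by (rule linear_scaleI)
    (rule injD[OF inj_fsubst],
      simp add: fsubst_coords lin_add[OF lin_const_part] lin_scale[OF lin_const_part]
        lin_add[OF lin_fsubst] lin_scale[OF lin_fsubst])+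

lemma tensor_map_coords_fsubst:
  "tensor_map coords coords (tensor_map (fsubst y) (fsubst y) t) = t"
  by (simp add: tensor_map_comp lin_coords coords_fsubst tensor_map_id)

lemma tensor_map_fsubst_inject:
  "tensor_map (fsubst y) (fsubst y) s = tensor_map (fsubst y) (fsubst y) t \<Longrightarrow> s = t"
  by (metis tensor_map_coords_fsubst)

text \<open>The projection to the constants is the identity minus a map that factors through the
  derivative, and the derivative vanishes on either factor of the coproduct of a constant.\<close>

lemma const_part_coadd:
  fixes c :: "(unit, 'k) free_alg"
  assumes "c \<in> constants"
  shows "tensor_map const_part const_part (coadd c) = coadd c"
proof -
  let ?Q = "\<lambda>f :: (unit, 'k) free_alg. times_x (inv (\<lambda>g. ddx (times_x g)) f)"
  have linQ: "lin ?Q"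
    by (rule lin_intros lin_inv_ddx_times_x)+
  have left: "tensor_map const_part (\<lambda>p. p) (coadd c) = coadd c"
  proof -
    have "tensor_map const_part (\<lambda>p. p) t = t - tensor_map ?Q (\<lambda>p. p) (tensor_map ddx (\<lambda>p. p) t)"
      for t :: "(unit, 'k) free_alg2"
    proof (rule linear_eq_on_basis[where f = "tensor_map const_part (\<lambda>p. p)"])
      fix b :: "unit magma option \<times> unit magma option"
      show "tensor_map const_part (\<lambda>p. p) (basis b) =
          basis b - tensor_map ?Q (\<lambda>p. p) (tensor_map ddx (\<lambda>p. p) (basis b))"
        by (cases b) (simp add: tensor_map_basis tensor_map_tensor[OF linQ linear_id_scale]
            const_part_def tensor_linear)
    qed (rule lin_tensor_map lin_intros)+
    then show ?thesis
      using assms by (simp add: ddx_left_coadd constants_def lin_zero[OF lin_coadd] lin_zero[OF lin_tensor_map])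
  qed
  have right: "tensor_map (\<lambda>p. p) const_part (coadd c) = coadd c"
    using arg_cong[OF left, of flip] by (simp add: flip_tensor_map flip_coadd)
  have "tensor_map const_part const_part (coadd c) =
      tensor_map const_part (\<lambda>p. p) (tensor_map (\<lambda>p. p) const_part (coadd c))"
    by (rule tensor_map_comp[OF lin_const_part linear_id_scale, symmetric])
  then show ?thesis
    by (simp add: left right)
qed

lemma restricted_coadd_iff:
  "restricted_coadd y D \<longleftrightarrow> D = (\<lambda>f. tensor_map coords coords (coadd (fsubst y f)))"
proof
  assume "restricted_coadd y D"
  then have "tensor_map coords coords (coadd (fsubst y f)) = D f" for f
    unfolding restricted_coadd_def by (metis tensor_map_coords_fsubst)
  then show "D = (\<lambda>f. tensor_map coords coords (coadd (fsubst y f)))"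
    by simp
next
  assume D: "D = (\<lambda>f. tensor_map coords coords (coadd (fsubst y f)))"
  show "restricted_coadd y D"
    unfolding restricted_coadd_def D
    by (simp add: tensor_map_comp[OF lin_fsubst lin_fsubst] fsubst_coords const_part_coadd
        fsubst_in_constants)
qed

text \<open>The embedding intertwines the grading operators of \<open>K{Y}\<close> and \<open>K{x}\<close>, so it reflects
  their eigenvectors.\<close>

lemma coords_graded:
  assumes "supp (fsubst y f) \<subseteq> {v. deg v = n}"
  shows "supp f \<subseteq> {u. weight d u = n}"
proof -
  have "fsubst y (euler (weight d) f) = euler deg (fsubst y f)"
    by (rule euler_commute[OF lin_fsubst supp_fsubst, symmetric])
  also have "\<dots> = fsubst y (scale (of_nat n) f)"
    using assms by (simp add: lin_scale[OF lin_fsubst] flip: euler_eigenvector_iff)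
  finally show ?thesis
    by (simp add: inj_eq[OF inj_fsubst] euler_eigenvector_iff)
qed

text \<open>There are no constants of degree \<open>1\<close>, so the values of the Dynkin operator on
  constants are primitive elements without linear term.\<close>

lemma dynkin_fsubst_constant: "dynkin (fsubst y (basis u)) \<in> constants"
proof (rule primitive_imp_constant[OF primitive_dynkin])
  have "weight d u \<noteq> 1"
  proof (cases u)
    case (Some t)
    have "3 \<le> magma_weight d t"
      by (induction t) (use degree_ge_3 in \<open>auto intro: trans_le_add1\<close>)
    then show ?thesis by (simp add: Some weight_def)
  qed simp
  then show "coeff (dynkin (fsubst y (basis u))) (Some (Leaf ())) = 0"
    using supp_dynkin[OF supp_fsubst[of u]] by (auto simp: in_keys_iff)
qed

definition dynkin_coords :: "nat magma option \<Rightarrow> (nat, 'k) free_alg"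
  where "dynkin_coords u = coords (dynkin (fsubst y (basis u)))"

lemma fsubst_dynkin_coords: "fsubst y (dynkin_coords u) = dynkin (fsubst y (basis u))"
  by (simp add: dynkin_coords_def fsubst_coords const_part_of_constant dynkin_fsubst_constant)

lemma supp_dynkin_coords: "supp (dynkin_coords u) \<subseteq> {v. weight d v = weight d u}"
  by (rule coords_graded) (simp only: fsubst_dynkin_coords supp_dynkin[OF supp_fsubst])

context
  fixes D assumes D: "restricted_coadd y D"
begin

lemma fsubst_D: "tensor_map (fsubst y) (fsubst y) (D f) = coadd (fsubst y f)"
  using D by (simp add: restricted_coadd_def)

lemma alg_hom_D: "alg_hom fmul fone tmul tone D"
  unfolding alg_hom_def
proof (intro conjI allI)
  note T = alg_homD[OF tensor_map_alg_hom[OF alg_hom_fsubst[of y]]]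
  note f = alg_homD[OF alg_hom_comp[OF alg_hom_coadd alg_hom_fsubst[of y]]]
  show "lin D"
    using D unfolding restricted_coadd_iff
    by (simp add: linear_comp[OF lin_tensor_map f(1)])
  show "D fone = tone"
    by (rule tensor_map_fsubst_inject) (simp add: fsubst_D T f)
  show "D (fmul p q) = tmul (D p) (D q)" for p q
    by (rule tensor_map_fsubst_inject) (simp add: fsubst_D T f)
qed

text \<open>The injective map \<open>fsubst y \<otimes> fsubst y\<close> intertwines the total gradings, so the
  homogeneity of \<open>coadd (y i)\<close> carries over to \<open>D (gen i)\<close>.\<close>

lemma supp_D_gen: "supp (D (gen i)) \<subseteq> {(u, v). weight d u + weight d v = d i}"
proof -
  let ?wt = "\<lambda>(u, v). weight d u + weight d v" and ?deg = "\<lambda>(u :: unit magma option, v :: unit magma option). deg u + deg v"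
  have "tensor_map (fsubst y) (fsubst y) (euler ?wt (D (gen i))) =
      euler ?deg (tensor_map (fsubst y) (fsubst y) (D (gen i)))"
  proof (rule euler_commute[OF lin_tensor_map, symmetric])
    fix b :: "nat magma option \<times> nat magma option"
    obtain u v where b: "b = (u, v)" by (cases b)
    show "supp (tensor_map (fsubst y) (fsubst y) (basis b)) \<subseteq> {c. ?deg c = ?wt b}"
      by (auto simp: b tensor_map_basis supp_tensor dest!: subsetD[OF supp_fsubst])
  qed
  also have "\<dots> = coadd (euler deg (fsubst y (gen i)))"
    unfolding fsubst_D
    by (rule euler_commute[OF lin_coadd]) (use supp_coadd_basis in force)
  also have "euler deg (fsubst y (gen i)) = fsubst y (scale (of_nat (d i)) (gen i))"
    using supp_fsubst[of "Some (Leaf i)"]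
    by (simp add: lin_scale[OF lin_fsubst] euler_eigenvector_iff) (simp add: gen_def)
  also have "coadd \<dots> = tensor_map (fsubst y) (fsubst y) (scale (of_nat (d i)) (D (gen i)))"
    by (simp add: lin_scale[OF lin_fsubst] lin_scale[OF lin_coadd] lin_scale[OF lin_tensor_map] fsubst_D)
  finally have "euler ?wt (D (gen i)) = scale (of_nat (d i)) (D (gen i))"
    by (rule tensor_map_fsubst_inject)
  then show ?thesis
    by (auto simp: euler_eigenvector_iff)
qed

text \<open>The terms with \<open>h\<^sub>1 \<noteq> 1\<close> in the recursion of the Dynkin operator for
  \<open>h = y i\<close>. Since \<open>D (gen i)\<close> writes the coproduct in terms of constants, these terms are
  products of two constants without constant term.\<close>

definition decomposable_part :: "nat \<Rightarrow> (nat, 'k) free_alg"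
  where "decomposable_part i =
    lin_ext (\<lambda>(u, v). if u = None then 0 else fmul (basis u) (dynkin_coords v)) (D (gen i))"

lemma supp_decomposable_part: "supp (decomposable_part i) \<subseteq> {u. 2 \<le> deg u \<and> weight d u = d i}"
proof
  fix w assume "w \<in> supp (decomposable_part i)"
  then obtain u v where uv: "(u, v) \<in> supp (D (gen i))" "u \<noteq> None"
    and w: "w \<in> supp (fmul (basis u) (dynkin_coords v))"
    using supp_lin_ext unfolding decomposable_part_def by (fastforce split: if_splits)
  have weight_uv: "weight d u + weight d v = d i"
    using supp_D_gen uv(1) by blast
  obtain v' where v': "v' \<in> supp (dynkin_coords v)" "w = umul u v'"
    using w supp_bilin_ext[of umul "basis u" "dynkin_coords v"] unfolding fmul_def by auto
  have weight_v': "weight d v' = weight d v"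
    using supp_dynkin_coords v'(1) by blast
  have "v' \<noteq> None"
  proof
    assume "v' = None"
    with weight_v' have "weight d v = 0" by simp
    then have "v = None"
      using weight_pos[of d v] degree_pos by (cases "v = None") simp_all
    have "dynkin (fone :: (unit, 'k) free_alg) = 0"
      by (simp add: dynkin_def fone_def dynkin_monomial.simps)
    then have "dynkin_coords None = 0"
      by (simp add: dynkin_coords_def fsubst_basis lin_zero[OF lin_coords])
    with v'(1) \<open>v = None\<close> show False by simp
  qed
  then show "w \<in> {u. 2 \<le> deg u \<and> weight d u = d i}"
    using deg_pos[OF uv(2)] deg_pos[of v'] weight_uv weight_v'
    by (simp add: v'(2) deg_umul weight_umul)
qed

lemma dynkin_generator:
  "dynkin (y i) = fsubst y (scale (of_nat (d i)) (gen i) - decomposable_part i)"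
proof -
  have "reduced_dynkin (tensor_map (fsubst y) (fsubst y) t) =
      fsubst y (lin_ext (\<lambda>(u, v). if u = None then 0 else fmul (basis u) (dynkin_coords v)) t)" for t
  proof (rule linear_eq_on_basis[where f = "\<lambda>t. reduced_dynkin (tensor_map (fsubst y) (fsubst y) t)"])
    fix b :: "nat magma option \<times> nat magma option"
    obtain u v where b: "b = (u, v)" by (cases b)
    show "reduced_dynkin (tensor_map (fsubst y) (fsubst y) (basis b)) =
        fsubst y (lin_ext (\<lambda>(u, v). if u = None then 0 else fmul (basis u) (dynkin_coords v)) (basis b))"
      by (cases u)
        (simp_all add: b tensor_map_basis fsubst_basis(1) reduced_dynkin_tensor_fone
          reduced_dynkin_tensor coeff_fsubst_None lin_zero[OF lin_fsubst]
          alg_homD(3)[OF alg_hom_fsubst] fsubst_dynkin_coords)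
  qed (rule linear_comp[OF lin_reduced_dynkin lin_tensor_map] linear_comp[OF lin_fsubst linear_lin_ext])+
  from this[of "D (gen i)"] have "reduced_dynkin (coadd (y i)) = fsubst y (decomposable_part i)"
    unfolding fsubst_D fsubst_gen decomposable_part_def .
  moreover have "euler deg (y i) = scale (of_nat (d i)) (y i)"
    using free by (auto simp: euler_eigenvector_iff free_generators_def homogeneous_def)
  ultimately show ?thesis
    by (simp add: dynkin_recursion[of "y i"] lin_diff[OF lin_fsubst] lin_scale[OF lin_fsubst] fsubst_gen)
qed

text \<open>By the previous lemma this is the Dynkin operator at \<open>y i\<close>, divided by the degree.\<close>

definition primitive_generator :: "nat \<Rightarrow> (nat, 'k) free_alg"
  where "primitive_generator i = gen i - scale (inverse (of_nat (d i))) (decomposable_part i)"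

lemma D_primitive_generator:
  "D (primitive_generator i) = tensor (primitive_generator i) fone + tensor fone (primitive_generator i)"
proof (rule tensor_map_fsubst_inject)
  have "d i \<noteq> 0"
    using degree_ge_3[of i] by simp
  then have z: "fsubst y (primitive_generator i) = scale (inverse (of_nat (d i))) (dynkin (y i))"
    unfolding dynkin_generator primitive_generator_def
    by (simp add: lin_diff[OF lin_fsubst] lin_scale[OF lin_fsubst] scale_distribs)
  have "coadd (fsubst y (primitive_generator i)) =
      tensor (fsubst y (primitive_generator i)) fone + tensor fone (fsubst y (primitive_generator i))"
    using primitive_dynkin[of "y i"] unfolding z primitive_def
    by (simp add: lin_scale[OF lin_coadd] tensor_linear scale_distribs)
  then show "tensor_map (fsubst y) (fsubst y) (D (primitive_generator i)) =
      tensor_map (fsubst y) (fsubst y)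
        (tensor (primitive_generator i) fone + tensor fone (primitive_generator i))"
    by (simp add: fsubst_D lin_add[OF lin_tensor_map] tensor_map_tensor[OF lin_fsubst lin_fsubst]
        alg_homD(2)[OF alg_hom_fsubst])
qed

text \<open>Mapping the free generators to the primitive ones intertwines the two co-additions, since
  both composites are algebra homomorphisms that agree on the generators.\<close>

lemma D_isomorphic_coadd:
  "\<exists>\<phi>. alg_iso \<phi> \<and> coadd = tensor_map \<phi> \<phi> \<circ> D \<circ> inv \<phi> \<and> strict \<phi>"
proof -
  define \<psi> where "\<psi> = fsubst primitive_generator"
  have supp: "supp (primitive_generator i - gen i) \<subseteq> {u. 2 \<le> deg u \<and> weight d u = d i}" for i
  proof -
    have "primitive_generator i - gen i = scale (- inverse (of_nat (d i))) (decomposable_part i)"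
      by (auto intro!: poly_mapping_eqI simp: primitive_generator_def lookup_minus)
    then show ?thesis
      using supp_scale supp_decomposable_part by (metis subset_trans)
  qed
  have "bij \<psi>" "strict (inv \<psi>)"
    unfolding \<psi>_def by (rule strict_automorphism[OF degree_pos supp])+
  have hom: "alg_hom fmul fone fmul fone \<psi>"
    unfolding \<psi>_def by (rule alg_hom_fsubst)
  have inv: "alg_hom fmul fone fmul fone (inv \<psi>)"
    by (rule alg_hom_inv[OF hom \<open>bij \<psi>\<close>])
  have "(\<lambda>p. D (\<psi> p)) = (\<lambda>p. tensor_map \<psi> \<psi> (coadd p))"
  proof (rule alg_hom_unique[OF alg_hom_comp[OF alg_hom_D hom]
        alg_hom_comp[OF tensor_map_alg_hom[OF hom] alg_hom_coadd]])
    show "D (\<psi> (gen i)) = tensor_map \<psi> \<psi> (coadd (gen i))" for i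
      by (simp add: coadd_gen lin_add[OF lin_tensor_map] tensor_map_tensor alg_homD[OF hom])
        (simp add: \<psi>_def fsubst_gen D_primitive_generator)
  qed
  then have "tensor_map (inv \<psi>) (inv \<psi>) (D (\<psi> p)) = coadd p" for p
    by (simp add: fun_eq_iff tensor_map_comp[OF alg_homD(1)[OF inv] alg_homD(1)[OF inv]]
        bij_is_inj[OF \<open>bij \<psi>\<close>] tensor_map_id)
  then have "coadd = tensor_map (inv \<psi>) (inv \<psi>) \<circ> D \<circ> inv (inv \<psi>)"
    by (simp add: fun_eq_iff inv_inv_eq[OF \<open>bij \<psi>\<close>])
  moreover have "alg_iso (inv \<psi>)"
    using inv \<open>bij \<psi>\<close> by (simp add: alg_iso_def bij_imp_bij_inv)
  ultimately show ?thesis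
    using \<open>strict (inv \<psi>)\<close> by blast
qed

end

end

theorem theorem4p4:
  shows "(\<exists>(y :: nat \<Rightarrow> (unit, 'k::field_char_0) free_alg) d. free_generators y d) \<and>
    (\<forall>(y :: nat \<Rightarrow> (unit, 'k) free_alg) d. free_generators y d \<longrightarrow>
      (\<exists>!\<Delta>'. restricted_coadd y \<Delta>') \<and>
      (\<forall>\<Delta>'. restricted_coadd y \<Delta>' \<longrightarrow>
        (\<exists>\<phi> :: (nat, 'k) free_alg \<Rightarrow> (nat, 'k) free_alg.
          alg_iso \<phi> \<and> coadd = tensor_map \<phi> \<phi> \<circ> \<Delta>' \<circ> inv \<phi> \<and> strict \<phi>)))"
proof (intro conjI allI impI)
  show "\<exists>(y :: nat \<Rightarrow> (unit, 'k) free_alg) d. free_generators y d"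
    by (rule free_generators_exist)
next
  fix y :: "nat \<Rightarrow> (unit, 'k) free_alg" and d
  assume "free_generators y d"
  then interpret constants_basis y d
    by (rule constants_basis.intro)
  show "\<exists>!\<Delta>'. restricted_coadd y \<Delta>'"
    unfolding restricted_coadd_iff by blast
  show "\<exists>\<phi> :: (nat, 'k) free_alg \<Rightarrow> (nat, 'k) free_alg.
      alg_iso \<phi> \<and> coadd = tensor_map \<phi> \<phi> \<circ> \<Delta>' \<circ> inv \<phi> \<and> strict \<phi>"
    if "restricted_coadd y \<Delta>'" for \<Delta>'
    using that by (rule D_isomorphic_coadd)
qed

end
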